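(* There is an absolute constant $c>0$ such that for every finite set $A\subset\mathbb{R}$ with $|A|>1$ and $0\notin A$, $$|A-A|^3\,|AA|^{5}\;\geq\; c\,\frac{|A|^{10}}{\log^{1/2}|A|}.$$
   Context: For finite sets $A,B$ in a field, $A-A=\{a-b: a,b\in A\}$ and $AA=\{ab: a,b\in A\}$. Logarithms are base $2$. *)

theory Defs
  imports "HOL-Analysis.Analysis"
begin

(* The library's "A - B" on sets is set-theoretic difference, hence the separate constant. *)
definition difference_set :: "'a::field set \<Rightarrow> 'a set \<Rightarrow> 'a set" where
  "difference_set A B = {a - b | a b. a \<in> A \<and> b \<in> B}"

definition product_set :: "'a::field set \<Rightarrow> 'a set \<Rightarrow> 'a set" where
  "product_set A B = {a * b | a b. a \<in> A \<and> b \<in> B}"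

end

theory Submission
  imports Defs
begin

text \<open>
  Let \<open>D = A - A\<close>, \<open>M = |AA| / |A|\<close> and let \<open>r(d)\<close> be the number of representations \<open>d = a - b\<close>.
  Triples \<open>(a, b, c)\<close> give pairs \<open>(x, y) = (a - b, a - c)\<close> with \<open>x, y, x - y \<in> D\<close>. By Cauchy-Schwarz there are
  at least \<open>|A|^6 / \<Sum> r(d)^3\<close> of them, and the Szemeredi-Trotter theorem gives
  \<open>\<Sum> r(d)^3 \<lesssim> M^2 |A|^3 log |A|\<close>. In the other direction, \<open>y = (e x) / e - (x - y)\<close> for \<open>e \<in> A\<close>, where most
  products \<open>e x\<close> lie in a set of size \<open>O(M^2 |D|)\<close>, so that Szemeredi-Trotter bounds the number of pairs by
  \<open>O(|D|^2 M^(4/3) |A|^(-1/3))\<close>. Together this proves the theorem with \<open>(log |A|)^(3/2)\<close>.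

  To reach \<open>(log |A|)^(1/2)\<close>, two regimes are distinguished. If \<open>M\<close> is at most a fixed power of \<open>log |A|\<close>, then only
  \<open>O(log log |A|)\<close> dyadic ranges of \<open>r(d)\<close> contribute to the energy: small values are harmless, because most
  differences have few representations (otherwise one wins directly), and \<open>r(d) \<lesssim> M^(4/3) |A|^(2/3)\<close> for \<open>d \<noteq> 0\<close>.
  If \<open>M\<close> is larger, then either the products \<open>e x\<close> lie in a set that is smaller by a factor \<open>log |A|\<close>, or the energy
  can be restricted to the sets \<open>A \<inter> A / l\<close>, for which bounds independent of \<open>M\<close> (rich lines of the
  grid \<open>A \<times> A\<close>) save a power of \<open>M\<close>, which beats every power of \<open>log |A|\<close>.
\<close>

section \<open>The Szemeredi-Trotter bound for Cartesian products\<close>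

definition incidences :: "real set \<Rightarrow> real set \<Rightarrow> (real \<times> real) set \<Rightarrow> (real \<times> (real \<times> real)) set" where
  "incidences X Y L = {(x, l). x \<in> X \<and> l \<in> L \<and> fst l * x + snd l \<in> Y}"

text \<open>Cutting at the values of \<open>rank * r div card X\<close> keeps the classes in order.
  The ranks of one class lie in an integer interval of length at most \<open>(p - 1) div r\<close>,
  and \<open>r <= card X\<close> absorbs the rounding into the factor 2.\<close>

lemma monotone_equipartition:
  fixes X :: "real set"
  assumes "finite X" "0 < r" "r \<le> card X"
  obtains f :: "real \<Rightarrow> nat" where "\<And>x. x \<in> X \<Longrightarrow> f x < r"
    "\<And>x y. x \<in> X \<Longrightarrow> y \<in> X \<Longrightarrow> x \<le> y \<Longrightarrow> f x \<le> f y"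
    "\<And>j. r * card {x \<in> X. f x = j} \<le> 2 * card X"
proof -
  define p where "p = card X"
  define rk where "rk x = card {z \<in> X. z < x}" for x
  define f where "f x = rk x * r div p" for x
  have p: "0 < p" using assms by (simp add: p_def)
  have rk_less: "rk x < rk y" if "x \<in> X" "x < y" for x y
    unfolding rk_def using that assms(1) by (intro psubset_card_mono) auto
  have rk_lt: "rk x < p" if "x \<in> X" for x
    unfolding rk_def p_def using that assms(1) by (intro psubset_card_mono) auto
  have inj: "inj_on rk X"
    by (metis inj_onI linorder_neqE_linordered_idom order_less_irrefl rk_less)
  have "r * card {x \<in> X. f x = j} \<le> 2 * p" for j
  proof (cases "{x \<in> X. f x = j} = {}")
    case False
    define S where "S = rk ` {x \<in> X. f x = j}"
    have fin: "finite S" and ne: "S \<noteq> {}" using assms(1) False by (auto simp: S_def)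
    have cS: "card S = card {x \<in> X. f x = j}"
      unfolding S_def by (intro card_image inj_on_subset[OF inj]) auto
    have S: "j * p \<le> k * r" "k * r < (j + 1) * p" if "k \<in> S" for k
    proof -
      have "k * r div p = j" using that by (auto simp: S_def f_def)
      then show "j * p \<le> k * r" "k * r < (j + 1) * p"
        using p div_mult_mod_eq[of "k*r" p] mod_less_divisor[OF p, of "k*r"]
        by (auto simp: algebra_simps)
    qed
    have "S \<subseteq> {Min S..Min S + (p - 1) div r}"
    proof
      fix k assume k: "k \<in> S"
      have "Min S \<le> k" using fin k by simp
      moreover have "(k - Min S) * r \<le> p - 1"
        using S(2)[OF k] S(1)[OF Min_in[OF fin ne]] by (simp add: algebra_simps)
      then have "k - Min S \<le> (p - 1) div r"
        using assms(2) by (simp add: less_eq_div_iff_mult_less_eq)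
      ultimately show "k \<in> {Min S..Min S + (p - 1) div r}" by auto
    qed
    then have "card S \<le> (p - 1) div r + 1"
      using card_mono[of "{Min S..Min S + (p - 1) div r}" S] by simp
    then have "r * card S \<le> r * ((p - 1) div r) + r"
      by (metis distrib_left mult.right_neutral mult_le_mono2)
    also have "\<dots> \<le> (p - 1) + r" by simp
    also have "\<dots> \<le> 2 * p" using assms(3) by (simp add: p_def)
    finally show ?thesis by (simp add: cS)
  next
    case True
    then show ?thesis by (metis card.empty mult_0_right zero_le)
  qed
  moreover have "f x < r" if "x \<in> X" for x
  proof -
    have "rk x * r < p * r" using rk_lt[OF that] assms(2) by simp
    then show ?thesis unfolding f_def using p by (simp add: less_mult_imp_div_less mult.commute)
  qed
  moreover have "f x \<le> f y" if "x \<in> X" "y \<in> X" "x \<le> y" for x y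
  proof -
    have "rk x \<le> rk y" using rk_less[of x y] that by (cases "x = y") auto
    then show ?thesis unfolding f_def by (intro div_le_mono mult_le_mono1)
  qed
  ultimately show ?thesis by (intro that[of f]) (simp_all add: p_def)
qed

text \<open>In the cell count below a line pays 1 for each cell in which it has a point, and beyond
  that only for ordered pairs of distinct points; empty cells must cost nothing, hence the
  indicator.\<close>

lemma card_le_one_plus_offdiagonal:
  assumes "finite S"
  shows "card S \<le> (if S = {} then 0 else 1) + card {(x, y). x \<in> S \<and> y \<in> S \<and> x \<noteq> y}"
proof (cases "S = {}")
  case False
  then obtain s where s: "s \<in> S" by auto
  have "card (S - {s}) = card ((\<lambda>y. (s, y)) ` (S - {s}))"
    by (rule card_image[symmetric]) (auto simp: inj_on_def)
  also have "\<dots> \<le> card {(x, y). x \<in> S \<and> y \<in> S \<and> x \<noteq> y}"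
    by (rule card_mono[OF finite_subset[of _ "S \<times> S"]]) (use s assms in auto)
  finally have "card S - 1 \<le> card {(x, y). x \<in> S \<and> y \<in> S \<and> x \<noteq> y}"
    using s assms by simp
  then show ?thesis using False by simp
qed auto

text \<open>Consecutive blocks of \<open>X\<close> and \<open>Y\<close> cut the grid into
  \<open>r * r\<close> cells. A line of nonzero slope is monotone and meets at most
  \<open>2 * r\<close> of them. Two distinct points of a cell determine the line, so the pairs
  contribute at most \<open>r ^ 2 * (4 * card X * card Y / r ^ 2) ^ 2\<close>.\<close>

lemma grid_incidences_cells:
  fixes X Y :: "real set" and L :: "(real \<times> real) set"
  assumes fin: "finite X" "finite Y" "finite L" and L: "\<And>l. l \<in> L \<Longrightarrow> fst l \<noteq> 0"
    and r: "0 < r" "r \<le> card X" "r \<le> card Y"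
  shows "real (card (incidences X Y L))
    \<le> 2 * real r * real (card L) + 16 * (real (card X) ^ 2 * real (card Y) ^ 2) / real r ^ 2"
proof -
  obtain f where f: "\<And>x. x \<in> X \<Longrightarrow> f x < r"
    "\<And>x y. x \<in> X \<Longrightarrow> y \<in> X \<Longrightarrow> x \<le> y \<Longrightarrow> f x \<le> f y"
    "\<And>j. r * card {x \<in> X. f x = j} \<le> 2 * card X"
    using monotone_equipartition[OF fin(1) r(1,2)] by blast
  obtain g where g: "\<And>x. x \<in> Y \<Longrightarrow> g x < r"
    "\<And>x y. x \<in> Y \<Longrightarrow> y \<in> Y \<Longrightarrow> x \<le> y \<Longrightarrow> g x \<le> g y"
    "\<And>j. r * card {x \<in> Y. g x = j} \<le> 2 * card Y"
    using monotone_equipartition[OF fin(2) r(1,3)] by blast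
  define ev where "ev l x = fst l * x + snd l" for l :: "real \<times> real" and x
  define S where "S l c = {x \<in> X. ev l x \<in> Y \<and> (f x, g (ev l x)) = c}" for l c
  define C where "C = {..<r} \<times> {..<r}"
  define Of where "Of l c = {(x, y). x \<in> S l c \<and> y \<in> S l c \<and> x \<noteq> y}" for l c
  have finS: "finite (S l c)" for l c using fin by (simp add: S_def)
  have finOf: "finite (Of l c)" for l c
    by (rule finite_subset[of _ "S l c \<times> S l c"]) (use finS in \<open>auto simp: Of_def\<close>)
  have finC: "finite C" by (simp add: C_def)
  let ?I = "incidences X Y L"
  have "card ?I = card (SIGMA l:L. SIGMA c:C. S l c)"
    by (rule bij_betw_same_card[of "\<lambda>(x, l). (l, (f x, g (ev l x)), x)"],
        rule bij_betw_byWitness[where f' = "\<lambda>(l, c, x). (x, l)"])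
       (use f(1) g(1) in \<open>auto simp: S_def C_def ev_def incidences_def\<close>)
  also have "\<dots> = (\<Sum>l\<in>L. \<Sum>c\<in>C. card (S l c))"
    using fin(3) finC finS by (simp add: card_SigmaI)
  also have "\<dots> \<le> (\<Sum>l\<in>L. \<Sum>c\<in>C. (if S l c = {} then 0 else 1) + card (Of l c))"
    unfolding Of_def by (intro sum_mono card_le_one_plus_offdiagonal finS)
  also have "\<dots> = (\<Sum>l\<in>L. card {c \<in> C. S l c \<noteq> {}}) + (\<Sum>l\<in>L. \<Sum>c\<in>C. card (Of l c))"
  proof -
    have "(\<Sum>c\<in>C. if S l c = {} then 0 else 1) = card {c \<in> C. S l c \<noteq> {}}" for l
    proof -
      have "(\<Sum>c\<in>C. if S l c = {} then 0 else 1) = (\<Sum>c\<in>C. if S l c \<noteq> {} then 1 else (0::nat))"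
        by (rule sum.cong) auto
      also have "\<dots> = card {c \<in> C. S l c \<noteq> {}}"
        using finC by (subst sum.inter_filter[symmetric]) auto
      finally show ?thesis .
    qed
    then show ?thesis by (simp add: sum.distrib)
  qed
  finally have main: "card ?I \<le> \<dots>" .
  have "card {c \<in> C. S l c \<noteq> {}} \<le> 2 * r" if l: "l \<in> L" for l
  proof -
    \<comment> \<open>The cells met by an increasing line form a chain in both indices, so
      \<open>i + j\<close> separates them; for a decreasing line the second index is reversed first.
      All values stay below \<open>2 * r\<close>.\<close>
    let ?h = "\<lambda>(i, j). if fst l > 0 then i + j else i + (r - 1 - j)"
    have "inj_on ?h {c \<in> C. S l c \<noteq> {}}"
    proof (rule inj_onI)
      fix c c' assume c: "c \<in> {c \<in> C. S l c \<noteq> {}}" "c' \<in> {c \<in> C. S l c \<noteq> {}}" and eq: "?h c = ?h c'"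
      obtain x where x: "x \<in> S l c" using c by auto
      obtain x' where x': "x' \<in> S l c'" using c by auto
      have rr: "snd c < r" "snd c' < r" using c by (auto simp: C_def)
      have mono: "fst d \<le> fst d' \<and> (if fst l > 0 then snd d \<le> snd d' else snd d' \<le> snd d)"
        if "u \<in> S l d" "u' \<in> S l d'" "u \<le> u'" for u u' d d'
      proof (cases "fst l > 0")
        case True
        then have "ev l u \<le> ev l u'" using that(3) by (simp add: ev_def)
        then show ?thesis using that f(2) g(2) True by (auto simp: S_def)
      next
        case False
        then have "ev l u' \<le> ev l u" using that(3) by (simp add: ev_def mult_left_mono_neg)
        then show ?thesis using that f(2) g(2) False by (auto simp: S_def)
      qed
      show "c = c'"
      proof (cases "x \<le> x'")
        case True
        then show ?thesis using mono[OF x x'] eq rr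
          by (cases c; cases c') (auto split: if_splits)
      next
        case False
        then show ?thesis using mono[OF x' x] eq rr
          by (cases c; cases c') (auto split: if_splits)
      qed
    qed
    moreover have "?h ` {c \<in> C. S l c \<noteq> {}} \<subseteq> {..<2 * r}"
      by (auto simp: C_def split: if_splits)
    ultimately have "card {c \<in> C. S l c \<noteq> {}} \<le> card {..<2 * r}"
      by (meson card_inj_on_le finite_lessThan)
    then show ?thesis by simp
  qed
  then have b1: "(\<Sum>l\<in>L. card {c \<in> C. S l c \<noteq> {}}) \<le> 2 * r * card L"
    using sum_bounded_above[of L "\<lambda>l. card {c \<in> C. S l c \<noteq> {}}" "2 * r"] by (simp add: mult.commute)
  have b2: "(\<Sum>l\<in>L. card (Of l c)) * r ^ 4 \<le> 16 * (card X ^ 2 * card Y ^ 2)" for c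
  proof -
    define Pc where "Pc = {x \<in> X. f x = fst c} \<times> {y \<in> Y. g y = snd c}"
    have finP: "finite Pc" using fin by (simp add: Pc_def)
    have "(\<Sum>l\<in>L. card (Of l c)) = card (SIGMA l:L. Of l c)"
      using fin finOf by (simp add: card_SigmaI)
    also have "\<dots> \<le> card (Pc \<times> Pc)"
    proof (rule card_inj_on_le[of "\<lambda>(l, x, x'). ((x, ev l x), (x', ev l x'))"])
      show "inj_on (\<lambda>(l, x, x'). ((x, ev l x), (x', ev l x'))) (SIGMA l:L. Of l c)"
      proof (rule inj_onI)
        fix u v assume u: "u \<in> (SIGMA l:L. Of l c)" and v: "v \<in> (SIGMA l:L. Of l c)"
          and eq: "(\<lambda>(l, x, x'). ((x, ev l x), (x', ev l x'))) u = (\<lambda>(l, x, x'). ((x, ev l x), (x', ev l x'))) v"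
        obtain l x x' where u': "u = (l, x, x')" by (cases u) auto
        obtain m y y' where v': "v = (m, y, y')" by (cases v) auto
        have xy: "x = y" "x' = y'" "x \<noteq> x'" using u eq unfolding u' v' by (auto simp: Of_def)
        have e: "fst l * x + snd l = fst m * x + snd m" "fst l * x' + snd l = fst m * x' + snd m"
          using eq xy unfolding u' v' by (auto simp: ev_def)
        then have "(fst l - fst m) * (x - x') = 0" by (simp add: algebra_simps)
        then have "fst l = fst m" using xy by simp
        then show "u = v" using e xy by (simp add: u' v' prod_eq_iff)
      qed
    qed (use finP in \<open>auto simp: Of_def S_def Pc_def\<close>)
    also have "\<dots> = (card {x \<in> X. f x = fst c} * card {y \<in> Y. g y = snd c}) ^ 2"
      by (simp add: Pc_def card_cartesian_product power2_eq_square)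
    finally have "(\<Sum>l\<in>L. card (Of l c)) * r ^ 4
      \<le> (card {x \<in> X. f x = fst c} * card {y \<in> Y. g y = snd c}) ^ 2 * r ^ 4" by simp
    also have "\<dots> = ((r * card {x \<in> X. f x = fst c}) * (r * card {y \<in> Y. g y = snd c})) ^ 2"
      by (simp add: power_mult_distrib power2_eq_square power4_eq_xxxx)
    also have "\<dots> \<le> ((2 * card X) * (2 * card Y)) ^ 2"
      by (intro power_mono mult_mono f g) auto
    finally show ?thesis by (simp add: power_mult_distrib)
  qed
  have "(\<Sum>l\<in>L. \<Sum>c\<in>C. card (Of l c)) * r ^ 4 = (\<Sum>c\<in>C. (\<Sum>l\<in>L. card (Of l c)) * r ^ 4)"
    by (subst sum.swap) (simp add: sum_distrib_right)
  also have "\<dots> \<le> r\<^sup>2 * (16 * (card X ^ 2 * card Y ^ 2))"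
    using sum_bounded_above[of C "\<lambda>c. (\<Sum>l\<in>L. card (Of l c)) * r ^ 4", OF b2]
    by (simp add: C_def card_cartesian_product power2_eq_square)
  finally have "(\<Sum>l\<in>L. \<Sum>c\<in>C. card (Of l c)) * r ^ 2 \<le> 16 * (card X ^ 2 * card Y ^ 2)"
    using r(1) by (simp add: power2_eq_square power4_eq_xxxx)
  then have "real ((\<Sum>l\<in>L. \<Sum>c\<in>C. card (Of l c)) * r ^ 2) \<le> real (16 * (card X ^ 2 * card Y ^ 2))"
    by (rule of_nat_mono)
  then have b3: "real (\<Sum>l\<in>L. \<Sum>c\<in>C. card (Of l c)) \<le> 16 * (real (card X) ^ 2 * real (card Y) ^ 2) / real r ^ 2"
    using r(1) by (simp add: pos_le_divide_eq)
  have "real (card ?I) \<le> real (2 * r * card L) + real (\<Sum>l\<in>L. \<Sum>c\<in>C. card (Of l c))"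
    using main b1 by linarith
  then show ?thesis using b3 by simp
qed

text \<open>This is the bound \<open>(|X| |Y| |L|)^(2/3) + |L|\<close> up to a constant, cubed to
  avoid fractional exponents. It follows from the cell count with \<open>r\<close> chosen to balance
  its two terms. Nonzero slopes also give the trivial bound \<open>|Y| |L|\<close>, as a line then
  has one point at each height.\<close>

theorem szemeredi_trotter_grid:
  fixes X Y :: "real set" and L :: "(real \<times> real) set"
  assumes fin: "finite X" "finite Y" "finite L" and L: "\<And>l. l \<in> L \<Longrightarrow> fst l \<noteq> 0"
  shows "real (card (incidences X Y L)) ^ 3
    \<le> 8000 * (real (card X) ^ 2 * real (card Y) ^ 2 * real (card L) ^ 2 + real (card L) ^ 3)"
    (is "real (card ?I) ^ 3 \<le> _")
proof -
  define p q l where "p = real (card X)" and "q = real (card Y)" and "l = real (card L)"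
  have nn: "p \<ge> 0" "q \<ge> 0" "l \<ge> 0" by (auto simp: p_def q_def l_def)
  have "card ?I \<le> card (X \<times> L)" by (rule card_mono) (use fin in \<open>auto simp: incidences_def\<close>)
  then have I1: "real (card ?I) \<le> p * l"
    unfolding p_def l_def of_nat_mult[symmetric] card_cartesian_product[symmetric]
    by (rule of_nat_mono)
  have "card ?I \<le> card (Y \<times> L)"
  proof (rule card_inj_on_le[of "\<lambda>(x, l). (fst l * x + snd l, l)"])
    show "inj_on (\<lambda>(x, l). (fst l * x + snd l, l)) ?I"
      by (auto simp: inj_on_def incidences_def dest: L)
  qed (use fin in \<open>auto simp: incidences_def\<close>)
  then have I2: "real (card ?I) \<le> q * l"
    unfolding q_def l_def of_nat_mult[symmetric] card_cartesian_product[symmetric]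
    by (rule of_nat_mono)
  \<comment> \<open>In the second and third case the balancing \<open>r\<close> would reach
    \<open>card X\<close> or \<open>card Y\<close>; there the trivial bounds \<open>p * l\<close>
    and \<open>q * l\<close> are strong enough.\<close>
  consider "l = 0" | "l * p \<le> q\<^sup>2" | "l * q \<le> p\<^sup>2" | "l > 0" "q\<^sup>2 < l * p" "p\<^sup>2 < l * q"
    using nn by linarith
  then have "real (card ?I) ^ 3 \<le> 8000 * (p\<^sup>2 * q\<^sup>2 * l\<^sup>2 + l ^ 3)"
  proof cases
    case 1
    then show ?thesis using I1 by simp
  next
    case 2
    have "real (card ?I) ^ 3 \<le> (p * l) ^ 3" using I1 by (intro power_mono) auto
    also have "\<dots> = p\<^sup>2 * l\<^sup>2 * (l * p)" by (simp add: power2_eq_square power3_eq_cube)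
    also have "\<dots> \<le> p\<^sup>2 * l\<^sup>2 * q\<^sup>2" using 2 by (intro mult_left_mono) auto
    also have "\<dots> \<le> 8000 * (p\<^sup>2 * q\<^sup>2 * l\<^sup>2 + l ^ 3)" using nn by (simp add: algebra_simps)
    finally show ?thesis .
  next
    case 3
    have "real (card ?I) ^ 3 \<le> (q * l) ^ 3" using I2 by (intro power_mono) auto
    also have "\<dots> = q\<^sup>2 * l\<^sup>2 * (l * q)" by (simp add: power2_eq_square power3_eq_cube)
    also have "\<dots> \<le> q\<^sup>2 * l\<^sup>2 * p\<^sup>2" using 3 by (intro mult_left_mono) auto
    also have "\<dots> \<le> 8000 * (p\<^sup>2 * q\<^sup>2 * l\<^sup>2 + l ^ 3)" using nn by (simp add: algebra_simps)
    finally show ?thesis .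
  next
    case 4
    have pq: "p > 0" "q > 0"
      using 4 nn zero_le_power2[of p] zero_le_power2[of q]
      by (metis less_eq_real_def mult_zero_right not_le)+
    \<comment> \<open>The solution of \<open>\<rho> * l = p^2 * q^2 / \<rho>^2\<close>, at which
      both terms of the cell count have the same order.\<close>
    define \<rho> where "\<rho> = root 3 (p\<^sup>2 * q\<^sup>2 / l)"
    have \<rho>0: "\<rho> > 0" using pq 4 by (simp add: \<rho>_def)
    have \<rho>3: "\<rho> ^ 3 = p\<^sup>2 * q\<^sup>2 / l" using pq 4 by (simp add: \<rho>_def)
    have "\<rho> ^ 3 < p ^ 3"
    proof -
      have "p\<^sup>2 * q\<^sup>2 < p\<^sup>2 * (l * p)" using 4 pq by simp
      then show ?thesis unfolding \<rho>3 using 4 by (simp add: divide_simps power2_eq_square power3_eq_cube mult_ac)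
    qed
    then have \<rho>p: "\<rho> < p" using pq by (meson less_imp_le power_less_imp_less_base)
    have "\<rho> ^ 3 < q ^ 3"
    proof -
      have "q\<^sup>2 * p\<^sup>2 < q\<^sup>2 * (l * q)" using 4 pq by simp
      then show ?thesis unfolding \<rho>3 using 4 by (simp add: divide_simps power2_eq_square power3_eq_cube mult_ac)
    qed
    then have \<rho>q: "\<rho> < q" using pq by (meson less_imp_le power_less_imp_less_base)
    define r where "r = nat \<lceil>\<rho>\<rceil>"
    have r0: "0 < r" using \<rho>0 by (simp add: r_def)
    have r1: "\<rho> \<le> real r" "real r < \<rho> + 1" using \<rho>0 unfolding r_def by linarith+
    have "r \<le> card X" "r \<le> card Y"
      using \<rho>p \<rho>q unfolding r_def p_def q_def by (auto simp: nat_le_iff ceiling_le_iff)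
    then have "real (card ?I) \<le> 2 * real r * l + 16 * (p\<^sup>2 * q\<^sup>2) / real r ^ 2"
      using grid_incidences_cells[OF fin L r0] by (simp add: p_def q_def l_def)
    also have "16 * (p\<^sup>2 * q\<^sup>2) / real r ^ 2 \<le> 16 * (p\<^sup>2 * q\<^sup>2) / \<rho> ^ 2"
      using r1 \<rho>0 r0 by (intro divide_left_mono power_mono mult_pos_pos) auto
    also have "\<dots> = 16 * l * \<rho>"
    proof -
      have "p\<^sup>2 * q\<^sup>2 = l * \<rho> ^ 3" using \<rho>3 4 by simp
      then show ?thesis using \<rho>0 by (simp add: power2_eq_square power3_eq_cube)
    qed
    finally have I: "real (card ?I) \<le> 2 * real r * l + 16 * l * \<rho>" by simp
    show ?thesis
    proof (cases "\<rho> \<ge> 1")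
      case True
      \<comment> \<open>Rounding \<open>\<rho>\<close> up at most doubles it, so the factor is
        \<open>2 * 2 + 16 = 20\<close>, and \<open>20 ^ 3 = 8000\<close>.\<close>
      have "real (card ?I) \<le> 20 * (l * \<rho>)"
      proof -
        have "real r \<le> 2 * \<rho>" using r1 True by linarith
        then have "2 * real r * l \<le> 2 * (2 * \<rho>) * l" using nn by (intro mult_right_mono mult_left_mono) auto
        then show ?thesis using I by (simp add: mult_ac)
      qed
      then have "real (card ?I) ^ 3 \<le> (20 * (l * \<rho>)) ^ 3" by (intro power_mono) auto
      also have "\<dots> = 8000 * (l ^ 3 * \<rho> ^ 3)" by (simp add: power_mult_distrib)
      also have "l ^ 3 * \<rho> ^ 3 = p\<^sup>2 * q\<^sup>2 * l\<^sup>2" unfolding \<rho>3 using 4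
        by (simp add: power2_eq_square power3_eq_cube)
      also have "8000 * (p\<^sup>2 * q\<^sup>2 * l\<^sup>2) \<le> 8000 * (p\<^sup>2 * q\<^sup>2 * l\<^sup>2 + l ^ 3)" using nn by simp
      finally show ?thesis .
    next
      case False
      then have "r = 1" using r0 r1 by linarith
      then have "real (card ?I) \<le> 2 * l + 16 * l * \<rho>" using I by simp
      also have "\<dots> \<le> 2 * l + 16 * l * 1" using False nn by (intro add_left_mono mult_left_mono) auto
      finally have "real (card ?I) ^ 3 \<le> (18 * l) ^ 3" by (intro power_mono) auto
      also have "\<dots> \<le> 8000 * l ^ 3" using nn by (simp add: power_mult_distrib)
      also have "\<dots> \<le> 8000 * (p\<^sup>2 * q\<^sup>2 * l\<^sup>2 + l ^ 3)" using nn by simp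
      finally show ?thesis .
    qed
  qed
  then show ?thesis by (simp add: p_def q_def l_def)
qed

section \<open>Representation functions and translation energies\<close>

text \<open>Cauchy-Schwarz over the fibres of \<open>f\<close>.\<close>

lemma card_squared_le_image_coincidences:
  assumes "finite S"
  shows "real (card S) ^ 2 \<le> real (card (f ` S)) * real (card {(s, t). s \<in> S \<and> t \<in> S \<and> f s = f t})"
proof -
  define F where "F y = {s \<in> S. f s = y}" for y
  have finF: "finite (F y)" for y using assms by (simp add: F_def)
  have "card S = card (SIGMA y:f ` S. F y)"
    by (rule bij_betw_same_card[of "\<lambda>s. (f s, s)"], rule bij_betw_byWitness[where f' = snd])
       (auto simp: F_def)
  then have 1: "real (card S) = (\<Sum>y\<in>f ` S. real (card (F y)))"
    using assms finF by (simp add: card_SigmaI)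
  have "card {(s, t). s \<in> S \<and> t \<in> S \<and> f s = f t} = card (SIGMA y:f ` S. F y \<times> F y)"
    by (rule bij_betw_same_card[of "\<lambda>(s, t). (f s, s, t)"], rule bij_betw_byWitness[where f' = snd])
       (auto simp: F_def)
  then have 2: "real (card {(s, t). s \<in> S \<and> t \<in> S \<and> f s = f t}) = (\<Sum>y\<in>f ` S. real (card (F y)) ^ 2)"
    using assms finF by (simp add: card_SigmaI card_cartesian_product power2_eq_square)
  show ?thesis
    using sum_squared_le_sum_of_squares[of "\<lambda>y. real (card (F y))" "f ` S"] unfolding 1 2
    by (simp add: mult.commute)
qed

text \<open>Each range from \<open>v\<close> to \<open>2 * v\<close> costs at most
  \<open>8 * B\<close>. The number \<open>k\<close> of ranges is a parameter because small doubling
  gets by with far fewer than \<open>log n\<close> of them.\<close>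

lemma dyadic_window_sum:
  fixes f :: "'a \<Rightarrow> real"
  assumes fin: "finite S" and B: "\<And>t. t > 0 \<Longrightarrow> real (card {s \<in> S. t \<le> f s}) * t ^ 3 \<le> B" and u: "u > 0"
  shows "(\<Sum>s \<in> {s \<in> S. u \<le> f s \<and> f s < 2 ^ k * u}. f s ^ 3) \<le> 8 * B * real k"
proof (induction k)
  case 0
  have "{s \<in> S. u \<le> f s \<and> f s < 2 ^ 0 * u} = {}" by auto
  then show ?case by (simp only: sum.empty)
next
  case (Suc k)
  define v where "v = 2 ^ k * u"
  have v: "v > 0" using u by (simp add: v_def)
  have uv: "u \<le> v" using u by (simp add: v_def)
  have eq: "{s \<in> S. u \<le> f s \<and> f s < 2 ^ Suc k * u}
      = {s \<in> S. u \<le> f s \<and> f s < 2 ^ k * u} \<union> {s \<in> S. v \<le> f s \<and> f s < 2 * v}"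
    using uv v by (auto simp: v_def)
  have "(\<Sum>s \<in> {s \<in> S. v \<le> f s \<and> f s < 2 * v}. f s ^ 3)
      \<le> (\<Sum>s \<in> {s \<in> S. v \<le> f s \<and> f s < 2 * v}. (2 * v) ^ 3)"
    using v by (intro sum_mono power_mono) auto
  also have "\<dots> = 8 * (real (card {s \<in> S. v \<le> f s \<and> f s < 2 * v}) * v ^ 3)"
    by (simp add: power_mult_distrib)
  also have "\<dots> \<le> 8 * (real (card {s \<in> S. v \<le> f s}) * v ^ 3)"
    using fin v by (intro mult_left_mono mult_right_mono of_nat_mono card_mono) auto
  also have "\<dots> \<le> 8 * B" using B[OF v] by simp
  finally have 1: "(\<Sum>s \<in> {s \<in> S. v \<le> f s \<and> f s < 2 * v}. f s ^ 3) \<le> 8 * B" .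
  have "(\<Sum>s \<in> {s \<in> S. u \<le> f s \<and> f s < 2 ^ Suc k * u}. f s ^ 3)
    = (\<Sum>s \<in> {s \<in> S. u \<le> f s \<and> f s < 2 ^ k * u}. f s ^ 3) + (\<Sum>s \<in> {s \<in> S. v \<le> f s \<and> f s < 2 * v}. f s ^ 3)"
    unfolding eq using fin by (intro sum.union_disjoint) (auto simp: v_def)
  then show ?case using Suc 1 by (simp add: algebra_simps)
qed

definition diff_pairs :: "real set \<Rightarrow> real \<Rightarrow> (real \<times> real) set" where
  "diff_pairs B d = {(a, b). a \<in> B \<and> b \<in> B \<and> a - b = d}"

definition rep :: "real set \<Rightarrow> real \<Rightarrow> real" where
  "rep B d = real (card (diff_pairs B d))"

lemma finite_diff_pairs [simp]: "finite B \<Longrightarrow> finite (diff_pairs B d)"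
  by (rule finite_subset[of _ "B \<times> B"]) (auto simp: diff_pairs_def)

lemma rep_nonneg [simp]: "0 \<le> rep B d"
  by (simp add: rep_def)

lemma rep_zero_or_ge1: "rep B d = 0 \<or> rep B d \<ge> 1"
  by (auto simp: rep_def Suc_le_eq)

lemma rep_le_card: "finite B \<Longrightarrow> rep B d \<le> real (card B)"
  unfolding rep_def of_nat_le_iff
  by (rule card_inj_on_le[of fst]) (auto simp: diff_pairs_def inj_on_def)

lemma sum_rep:
  assumes "finite B" "finite U"
  shows "(\<Sum>d\<in>U. rep B d) \<le> real (card B) ^ 2"
proof -
  have "(\<Sum>d\<in>U. rep B d) = real (card (SIGMA d:U. diff_pairs B d))"
    using assms by (simp add: card_SigmaI rep_def)
  also have "card (SIGMA d:U. diff_pairs B d) \<le> card (B \<times> B)"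
    by (rule card_inj_on_le[of snd]) (use assms in \<open>auto simp: diff_pairs_def inj_on_def\<close>)
  finally show ?thesis by (simp add: card_cartesian_product power2_eq_square)
qed

text \<open>Two triples \<open>(a, b, c)\<close>, \<open>(a', b', c')\<close> with the same differences \<open>a - b\<close>, \<open>a - c\<close> are
  translates of each other by \<open>d = a - a' = b - b' = c - c'\<close>.\<close>

lemma translation_energy:
  fixes B C :: "'i \<Rightarrow> real set"
  assumes fin: "finite I" "finite U" "\<And>i. i \<in> I \<Longrightarrow> finite (B i)" "\<And>i. i \<in> I \<Longrightarrow> finite (C i)"
    and \<Omega>: "\<And>i a b c. (i, a, b, c) \<in> \<Omega> \<Longrightarrow> i \<in> I \<and> a \<in> B i \<and> b \<in> B i \<and> c \<in> C i \<and> Pr (a - c)"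
    and U: "\<And>i a a'. i \<in> I \<Longrightarrow> a \<in> B i \<Longrightarrow> a' \<in> B i \<Longrightarrow> a - a' \<in> U"
  shows "real (card \<Omega>) ^ 2 \<le> real (card ((\<lambda>(i, a, b, c). (i, a - b, a - c)) ` \<Omega>)) *
    (\<Sum>i\<in>I. \<Sum>d\<in>U. rep (B i) d * real (card {((a, a'), (c, c')). (a, a') \<in> diff_pairs (B i) d \<and>
        (c, c') \<in> diff_pairs (C i) d \<and> Pr (a - c)}))"
proof -
  define f :: "'i \<times> real \<times> real \<times> real \<Rightarrow> 'i \<times> real \<times> real" where "f = (\<lambda>(i, a, b, c). (i, a - b, a - c))"
  define G where "G i d = {((a, a'), (c, c')). (a, a') \<in> diff_pairs (B i) d \<and>
        (c, c') \<in> diff_pairs (C i) d \<and> Pr (a - c)}" for i d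
  have finG: "finite (G i d)" if "i \<in> I" for i d
    by (rule finite_subset[of _ "diff_pairs (B i) d \<times> diff_pairs (C i) d"])
       (use fin that in \<open>auto simp: G_def\<close>)
  have "finite \<Omega>"
    by (rule finite_subset[of _ "SIGMA i:I. B i \<times> B i \<times> C i"]) (use fin \<Omega> in auto)
  then have "real (card \<Omega>) ^ 2 \<le> real (card (f ` \<Omega>)) * real (card {(s, t). s \<in> \<Omega> \<and> t \<in> \<Omega> \<and> f s = f t})"
    by (rule card_squared_le_image_coincidences)
  also have "card {(s, t). s \<in> \<Omega> \<and> t \<in> \<Omega> \<and> f s = f t} \<le> card (SIGMA i:I. SIGMA d:U. diff_pairs (B i) d \<times> G i d)"
  \<comment> \<open>A coincidence is encoded by the index, the translation and three translated
    pairs. The pair \<open>(b, b')\<close> is counted by \<open>rep\<close>; the other two stay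
    together since \<open>Pr\<close> links \<open>a\<close> and \<open>c\<close>.\<close>
  proof (rule card_inj_on_le[of "\<lambda>((i, a, b, c), (i', a', b', c')). (i, a - a', (b, b'), ((a, a'), (c, c')))"])
    show "inj_on (\<lambda>((i, a, b, c), (i', a', b', c')). (i, a - a', (b, b'), ((a, a'), (c, c'))))
        {(s, t). s \<in> \<Omega> \<and> t \<in> \<Omega> \<and> f s = f t}"
      by (auto simp: inj_on_def f_def)
    show "(\<lambda>((i, a, b, c), (i', a', b', c')). (i, a - a', (b, b'), ((a, a'), (c, c')))) `
        {(s, t). s \<in> \<Omega> \<and> t \<in> \<Omega> \<and> f s = f t} \<subseteq> (SIGMA i:I. SIGMA d:U. diff_pairs (B i) d \<times> G i d)"
      by (auto simp: f_def diff_pairs_def G_def dest!: \<Omega> intro: U)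
    show "finite (SIGMA i:I. SIGMA d:U. diff_pairs (B i) d \<times> G i d)"
      using fin finG by (intro finite_SigmaI) auto
  qed
  also have "real (card (SIGMA i:I. SIGMA d:U. diff_pairs (B i) d \<times> G i d))
     = (\<Sum>i\<in>I. \<Sum>d\<in>U. rep (B i) d * real (card (G i d)))"
    using fin finG by (simp add: card_SigmaI card_cartesian_product rep_def)
  finally show ?thesis by (simp add: f_def G_def mult_left_mono)
qed

lemma card_pair_coincidences_le:
  assumes "finite B" "finite C"
  shows "real (card {((a, a'), (c, c')). (a, a') \<in> diff_pairs B d \<and> (c, c') \<in> diff_pairs C d \<and> Pr (a - c)})
    \<le> rep B d * rep C d"
proof -
  have "card {((a, a'), (c, c')). (a, a') \<in> diff_pairs B d \<and> (c, c') \<in> diff_pairs C d \<and> Pr (a - c)}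
      \<le> card (diff_pairs B d \<times> diff_pairs C d)"
    using assms by (intro card_mono) auto
  then show ?thesis unfolding rep_def
    by (simp add: card_cartesian_product flip: of_nat_mult)
qed

text \<open>For \<open>l\<close> nonzero this is the intersection of \<open>A\<close> with
  \<open>A / l\<close>; its size is the number of representations of \<open>l\<close> as a quotient
  of elements of \<open>A\<close> when 0 is not in \<open>A\<close>.\<close>

definition dilate_part :: "real set \<Rightarrow> real \<Rightarrow> real set" where
  "dilate_part A l = {a \<in> A. l * a \<in> A}"

section \<open>Basic quantities attached to the set \<open>A\<close>\<close>

locale nonzero_set =
  fixes A :: "real set"
  assumes finA: "finite A" and nz: "0 \<notin> A" and card_gt1: "card A > 1"
begin

abbreviation "D \<equiv> difference_set A A"
abbreviation "AA \<equiv> product_set A A"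
definition n :: real where "n = real (card A)"
definition \<delta> :: real where "\<delta> = real (card D)"
definition P :: real where "P = real (card AA)"
abbreviation "r \<equiv> rep A"
abbreviation "dil \<equiv> dilate_part A"
definition J :: real where "J = log 2 n"

text \<open>The multiplicative doubling constant of \<open>A\<close>.\<close>

definition M :: real where "M = P / n"

text \<open>The quotient set \<open>A / A\<close>, described by the dilations under which some
  element of \<open>A\<close> stays in \<open>A\<close>.\<close>

definition Q :: "real set" where "Q = {l. dil l \<noteq> {}}"

lemma diffI: "a \<in> A \<Longrightarrow> b \<in> A \<Longrightarrow> a - b \<in> D"
  by (auto simp: difference_set_def)

lemma prodI: "a \<in> A \<Longrightarrow> b \<in> A \<Longrightarrow> a * b \<in> AA"
  by (auto simp: product_set_def)

lemma finD: "finite D"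
proof -
  have "D = (\<lambda>(a, b). a - b) ` (A \<times> A)" by (auto simp: difference_set_def)
  then show ?thesis using finA by simp
qed

lemma finAA: "finite AA"
proof -
  have "AA = (\<lambda>(a, b). a * b) ` (A \<times> A)" by (auto simp: product_set_def)
  then show ?thesis using finA by simp
qed

lemma n2: "n \<ge> 2" using card_gt1 by (simp add: n_def)

lemma n_pos: "n > 0" using n2 by simp

lemma J1: "J \<ge> 1"
  using n2 log_le_cancel_iff[of 2 2 n] by (simp add: J_def)

lemma n_le_P: "n \<le> P"
proof -
  obtain a where a: "a \<in> A" using card_gt1 by fastforce
  have "card A = card ((*) a ` A)"
    using a nz by (intro card_image[symmetric]) (auto simp: inj_on_def)
  also have "\<dots> \<le> card AA" using a finAA by (intro card_mono) (auto intro: prodI)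
  finally show ?thesis by (simp add: n_def P_def)
qed

lemma n_le_\<delta>: "n \<le> \<delta>"
proof -
  obtain a where a: "a \<in> A" using card_gt1 by fastforce
  have "card A = card ((\<lambda>x. x - a) ` A)"
    by (intro card_image[symmetric]) (auto simp: inj_on_def)
  also have "\<dots> \<le> card D" using a finD by (intro card_mono) (auto intro: diffI)
  finally show ?thesis by (simp add: n_def \<delta>_def)
qed

lemma P_eq: "P = M * n" using n_pos by (simp add: M_def)

lemma M1: "M \<ge> 1" using n_le_P n_pos by (simp add: M_def)

lemma dil_subset: "dil l \<subseteq> A" by (auto simp: dilate_part_def)

lemma fin_dil [simp]: "finite (dil l)" using dil_subset finA by (rule finite_subset)

lemma Q_nz: "l \<in> Q \<Longrightarrow> l \<noteq> 0"
  using nz by (auto simp: Q_def dilate_part_def)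

lemma Q_eq: "Q = (\<lambda>(a, b). a / b) ` (A \<times> A)"
proof safe
  fix l assume "l \<in> Q"
  then obtain a where "a \<in> A" "l * a \<in> A" by (auto simp: Q_def dilate_part_def)
  then show "l \<in> (\<lambda>(a, b). a / b) ` (A \<times> A)"
    using nz by (intro image_eqI[of _ _ "(l * a, a)"]) auto
next
  fix a b assume "a \<in> A" "b \<in> A"
  then show "a / b \<in> Q" using nz by (auto simp: Q_def dilate_part_def intro!: exI[of _ b])
qed

lemma finQ: "finite Q" unfolding Q_eq using finA by simp

lemma card_dil_le: "real (card (dil l)) \<le> n"
  using card_mono[OF finA dil_subset] by (simp add: n_def)

lemma r_le_n: "r d \<le> n"
  using rep_le_card[OF finA] by (simp add: n_def)

lemma sum_card_dil:
  assumes "S \<subseteq> Q" shows "(\<Sum>l\<in>S. real (card (dil l))) \<le> n ^ 2"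
proof -
  have "(\<Sum>l\<in>S. real (card (dil l))) = real (card (SIGMA l:S. dil l))"
    using finite_subset[OF assms finQ] by (simp add: card_SigmaI)
  also have "card (SIGMA l:S. dil l) \<le> card (A \<times> A)"
    by (rule card_inj_on_le[of "\<lambda>(l, a). (l * a, a)"])
       (use finA nz in \<open>auto simp: dilate_part_def inj_on_def\<close>)
  finally show ?thesis by (simp add: n_def card_cartesian_product power2_eq_square)
qed

lemma dyadic_levels: obtains k :: nat where "n < 2 ^ k" "real k \<le> 2 * J" "2 ^ k \<le> 2 * n"
proof -
  define k where "k = nat \<lfloor>J\<rfloor> + 1"
  have k: "real k = of_int \<lfloor>J\<rfloor> + 1" using J1 by (simp add: k_def)
  then have "J < real k" "real k \<le> J + 1" by linarith+
  have "n = 2 powr J" using n_pos by (simp add: J_def)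
  also have "\<dots> < 2 powr (real k)" using \<open>J < real k\<close> by simp
  finally have 1: "n < 2 ^ k" by (simp add: powr_realpow)
  have "2 powr (real k) \<le> 2 powr (J + 1)" using \<open>real k \<le> J + 1\<close> by simp
  also have "\<dots> = 2 * n" using n_pos by (simp add: powr_add J_def)
  finally have "2 ^ k \<le> 2 * n" by (simp add: powr_realpow)
  then show ?thesis using that[of k] 1 \<open>real k \<le> J + 1\<close> J1 by linarith
qed

end

section \<open>Applications of the incidence bound\<close>

text \<open>For discarding the linear term of the Szemeredi-Trotter bound once the main term
  dominates it; this is where 8000 becomes 16000.\<close>

lemma absorb_lower_term: "z \<le> 8000 * (x + y) \<Longrightarrow> y \<le> x \<Longrightarrow> z \<le> 16000 * (x :: real)"
  by (simp add: distrib_left)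

context nonzero_set
begin

text \<open>The identity \<open>y = (1 / e) * (e * x) - (x - y)\<close> puts the point
  \<open>(e * x, y)\<close> of \<open>X \<times> S\<close> on a line with slope \<open>1 / e\<close>
  and intercept in \<open>- D\<close>. There are \<open>card E * \<delta>\<close> such
  lines.\<close>

lemma dilation_incidences:
  assumes fin: "finite E" "finite X" "finite S" and E: "0 \<notin> E"
    and Z: "\<And>e x y. (e, x, y) \<in> Z \<Longrightarrow> e \<in> E \<and> e * x \<in> X \<and> y \<in> S \<and> x - y \<in> D"
  shows "real (card Z) ^ 3 \<le> 8000 * (real (card X) ^ 2 * real (card S) ^ 2 * (real (card E) * \<delta>) ^ 2
    + (real (card E) * \<delta>) ^ 3)"
proof -
  define L where "L = (\<lambda>(e, d). (1 / e, - d)) ` (E \<times> D)"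
  have finL: "finite L" using fin finD by (simp add: L_def)
  have "card L = card (E \<times> D)" unfolding L_def
    by (rule card_image) (use E in \<open>auto simp: inj_on_def\<close>)
  then have cL: "real (card L) = real (card E) * \<delta>" by (simp add: \<delta>_def card_cartesian_product)
  have "card Z \<le> card (incidences X S L)"
  proof (rule card_inj_on_le[of "\<lambda>(e, x, y). (e * x, (1 / e, - (x - y)))"])
    show "inj_on (\<lambda>(e, x, y). (e * x, (1 / e, - (x - y)))) Z"
      using E Z by (auto simp: inj_on_def)
    have "(e * x, (1 / e, - (x - y))) \<in> incidences X S L" if z: "(e, x, y) \<in> Z" for e x y
    proof -
      have "e \<noteq> 0" using E Z[OF z] by auto
      moreover have "(1 / e, - (x - y)) \<in> L" unfolding L_def
        using Z[OF z] by (intro image_eqI[of _ _ "(e, x - y)"]) auto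
      ultimately show ?thesis using Z[OF z] by (simp add: incidences_def)
    qed
    then show "(\<lambda>(e, x, y). (e * x, (1 / e, - (x - y)))) ` Z \<subseteq> incidences X S L" by auto
    show "finite (incidences X S L)"
      by (rule finite_subset[of _ "X \<times> L"]) (use fin finL in \<open>auto simp: incidences_def\<close>)
  qed
  then have "real (card Z) ^ 3 \<le> real (card (incidences X S L)) ^ 3" by (intro power_mono) auto
  also have "\<dots> \<le> 8000 * (real (card X) ^ 2 * real (card S) ^ 2 * real (card L) ^ 2 + real (card L) ^ 3)"
    using fin finL E by (intro szemeredi_trotter_grid) (auto simp: L_def)
  finally show ?thesis unfolding cL .
qed

text \<open>Each representation \<open>d = a - b\<close> gives, for every \<open>e\<close> in
  \<open>A\<close>, the incidence \<open>d = (1 / e) * (e * a) - b\<close> of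
  \<open>AA \<times> S\<close> with one of \<open>n ^ 2\<close> lines. So there are at least
  \<open>n * t * card S\<close> incidences.\<close>

lemma card_popular_differences:
  assumes "t > 0"
  shows "real (card {d \<in> D. t \<le> r d}) * t ^ 3 \<le> 16000 * M ^ 2 * n ^ 3"
proof -
  define S where "S = {d \<in> D. t \<le> r d}"
  define N where "N = real (card S)"
  have finS: "finite S" using finD by (simp add: S_def)
  define L where "L = (\<lambda>(e, b). (1 / e, - b)) ` (A \<times> A)"
  have finL: "finite L" using finA by (simp add: L_def)
  have "card L = card (A \<times> A)" unfolding L_def
    by (rule card_image) (auto simp: inj_on_def)
  then have cL: "real (card L) = n ^ 2" by (simp add: n_def card_cartesian_product power2_eq_square)
  have "card (SIGMA d:S. A \<times> diff_pairs A d) \<le> card (incidences AA S L)"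
  proof (rule card_inj_on_le[of "\<lambda>(d, e, a, b). (e * a, (1 / e, - b))"])
    show "inj_on (\<lambda>(d, e, a, b). (e * a, (1 / e, - b))) (SIGMA d:S. A \<times> diff_pairs A d)"
      using nz by (auto simp: inj_on_def diff_pairs_def)
    show "(\<lambda>(d, e, a, b). (e * a, (1 / e, - b))) ` (SIGMA d:S. A \<times> diff_pairs A d) \<subseteq> incidences AA S L"
      using nz by (auto simp: incidences_def diff_pairs_def L_def prodI)
    show "finite (incidences AA S L)"
      by (rule finite_subset[of _ "AA \<times> L"]) (use finAA finL in \<open>auto simp: incidences_def\<close>)
  qed
  then have "real (card (SIGMA d:S. A \<times> diff_pairs A d)) \<le> real (card (incidences AA S L))" by simp
  also have "real (card (SIGMA d:S. A \<times> diff_pairs A d)) = (\<Sum>d\<in>S. n * r d)"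
    using finS finA by (simp add: n_def card_SigmaI card_cartesian_product rep_def)
  finally have "(\<Sum>d\<in>S. n * r d) \<le> real (card (incidences AA S L))" .
  moreover have "(\<Sum>d\<in>S. n * t) \<le> (\<Sum>d\<in>S. n * r d)"
    using n_pos by (intro sum_mono mult_left_mono) (auto simp: S_def)
  ultimately have "n * t * N \<le> real (card (incidences AA S L))" by (simp add: N_def mult_ac)
  then have "(n * t * N) ^ 3 \<le> real (card (incidences AA S L)) ^ 3"
    using assms n_pos by (intro power_mono) (auto simp: N_def)
  also have "\<dots> \<le> 8000 * (P ^ 2 * N ^ 2 * real (card L) ^ 2 + real (card L) ^ 3)"
    unfolding N_def P_def using finAA finS finL nz by (intro szemeredi_trotter_grid) (auto simp: L_def)
  finally have I: "(n * t * N) ^ 3 \<le> 8000 * (P ^ 2 * N ^ 2 * n ^ 4 + n ^ 6)"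
    unfolding cL by (simp flip: power_mult)
  show ?thesis
  proof (cases "N = 0")
    case True
    then show ?thesis using M1 n_pos by (simp add: N_def S_def)
  next
    case False
    then have N: "N \<ge> 1" by (simp add: N_def Suc_le_eq)
    have "n ^ 6 \<le> P ^ 2 * N ^ 2 * n ^ 4"
    proof -
      have "n ^ 2 * 1 \<le> P ^ 2 * N ^ 2" using n_le_P N n_pos by (intro mult_mono power_mono) auto
      then have "n ^ 2 * n ^ 4 \<le> P ^ 2 * N ^ 2 * n ^ 4" using n_pos by (intro mult_right_mono) auto
      then show ?thesis by (simp flip: power_add)
    qed
    then have "(n * t * N) ^ 3 \<le> 16000 * (P ^ 2 * N ^ 2 * n ^ 4)" by (rule absorb_lower_term[OF I])
    also have "\<dots> = (N ^ 2 * n ^ 3) * (16000 * M ^ 2 * n ^ 3)"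
      unfolding P_eq by (simp add: power_mult_distrib power_numeral_reduce)
    finally have "(N ^ 2 * n ^ 3) * (N * t ^ 3) \<le> (N ^ 2 * n ^ 3) * (16000 * M ^ 2 * n ^ 3)"
      by (simp add: power_mult_distrib power_numeral_reduce mult_ac)
    moreover have "N ^ 2 * n ^ 3 > 0" using N n_pos by simp
    ultimately have "N * t ^ 3 \<le> 16000 * M ^ 2 * n ^ 3"
      by (simp only: mult_le_cancel_left_pos)
    then show ?thesis by (simp add: N_def S_def)
  qed
qed

text \<open>For \<open>a\<close> and \<open>a - d\<close> in \<open>A\<close>, any \<open>b\<close>,
  \<open>c\<close> in \<open>A\<close> satisfy
  \<open>c * (a - d) = (c / b) * (a * b) - c * d\<close>, an incidence on
  \<open>AA \<times> AA\<close>. Since \<open>d\<close> is nonzero, the intercept determines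
  \<open>c\<close> and the slope then determines \<open>b\<close>, so the \<open>n ^ 2\<close> lines
  are distinct.\<close>

lemma rep_bound_nonzero:
  assumes "d \<noteq> 0"
  shows "r d ^ 3 \<le> 16000 * M ^ 4 * n ^ 2"
proof -
  define L where "L = (\<lambda>(b, c). (c / b, - (c * d))) ` (A \<times> A)"
  have finL: "finite L" using finA by (simp add: L_def)
  have "card L = card (A \<times> A)" unfolding L_def
    by (rule card_image) (use assms nz in \<open>auto simp: inj_on_def\<close>)
  then have cL: "real (card L) = n ^ 2" by (simp add: n_def card_cartesian_product power2_eq_square)
  have "card (diff_pairs A d \<times> (A \<times> A)) \<le> card (incidences AA AA L)"
  proof (rule card_inj_on_le[of "\<lambda>((a, a'), (b, c)). (a * b, (c / b, - (c * d)))"])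
    show "inj_on (\<lambda>((a, a'), (b, c)). (a * b, (c / b, - (c * d)))) (diff_pairs A d \<times> (A \<times> A))"
      using assms nz by (auto simp: inj_on_def diff_pairs_def)
    have "c / b * (a * b) + - (c * d) \<in> AA"
      if "a \<in> A" "a - d \<in> A" "b \<in> A" "c \<in> A" for a b c
    proof -
      have "b \<noteq> 0" using that nz by auto
      then have "c / b * (a * b) + - (c * d) = c * (a - d)" by (simp add: algebra_simps)
      then show ?thesis using that by (simp add: prodI)
    qed
    then show "(\<lambda>((a, a'), (b, c)). (a * b, (c / b, - (c * d)))) ` (diff_pairs A d \<times> (A \<times> A)) \<subseteq> incidences AA AA L"
      by (auto simp: incidences_def diff_pairs_def L_def prodI)
    show "finite (incidences AA AA L)"
      by (rule finite_subset[of _ "AA \<times> L"]) (use finAA finL in \<open>auto simp: incidences_def\<close>)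
  qed
  then have "r d * n ^ 2 \<le> real (card (incidences AA AA L))"
    by (simp add: n_def card_cartesian_product rep_def power2_eq_square flip: of_nat_mult)
  then have "(r d * n ^ 2) ^ 3 \<le> real (card (incidences AA AA L)) ^ 3"
    by (intro power_mono) auto
  also have "\<dots> \<le> 8000 * (P ^ 2 * P ^ 2 * real (card L) ^ 2 + real (card L) ^ 3)"
    unfolding P_def using finAA finL nz by (intro szemeredi_trotter_grid) (auto simp: L_def)
  finally have "r d ^ 3 * n ^ 6 \<le> 8000 * (P ^ 4 * n ^ 4 + n ^ 6)"
    unfolding cL by (simp add: power_mult_distrib flip: power_mult power_add)
  moreover have "n ^ 6 \<le> P ^ 4 * n ^ 4"
  proof -
    have "n ^ 2 \<le> n ^ 4" using n2 by (intro power_increasing) auto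
    also have "\<dots> \<le> P ^ 4" using n_le_P n_pos by (intro power_mono) auto
    finally have "n ^ 2 * n ^ 4 \<le> P ^ 4 * n ^ 4" using n_pos by (intro mult_right_mono) auto
    then show ?thesis by (simp flip: power_add)
  qed
  ultimately have "r d ^ 3 * n ^ 6 \<le> 16000 * (P ^ 4 * n ^ 4)" by (rule absorb_lower_term)
  also have "\<dots> = (16000 * M ^ 4 * n ^ 2) * n ^ 6"
    unfolding P_eq by (simp add: power_mult_distrib power_numeral_reduce)
  finally show ?thesis using n_pos by simp
qed

lemma sum_rep_dil:
  assumes "S \<subseteq> Q"
  shows "(\<Sum>(l, d)\<in>S \<times> D. rep (dil l) d) \<le> n ^ 3"
proof -
  have finS: "finite S" using assms finQ finite_subset by blast
  have "(\<Sum>(l, d)\<in>S \<times> D. rep (dil l) d) = (\<Sum>l\<in>S. \<Sum>d\<in>D. rep (dil l) d)"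
    by (simp add: sum.cartesian_product)
  also have "\<dots> \<le> (\<Sum>l\<in>S. real (card (dil l)) ^ 2)"
    by (intro sum_mono sum_rep finD) auto
  also have "\<dots> \<le> (\<Sum>l\<in>S. n * real (card (dil l)))"
    unfolding power2_eq_square by (intro sum_mono mult_right_mono card_dil_le) auto
  also have "\<dots> = n * (\<Sum>l\<in>S. real (card (dil l)))" by (simp add: sum_distrib_left)
  also have "\<dots> \<le> n * n ^ 2" using sum_card_dil[OF assms] n_pos by (intro mult_left_mono) auto
  finally show ?thesis by (simp add: power_numeral_reduce)
qed

text \<open>The line \<open>y = x / l - d\<close> contains at least \<open>rep (dil l) d\<close> points of the grid \<open>A \<times> A\<close>, so these are the
  rich lines of that grid; in contrast to \<open>card_popular_differences\<close> the bound does not involve \<open>M\<close>.\<close>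

lemma card_rich_lines:
  assumes "t > 0"
  shows "real (card {z \<in> Q \<times> D. t \<le> (\<lambda>(l, d). rep (dil l) d) z}) * t ^ 3 \<le> 16000 * n ^ 4"
proof -
  define S where "S = {z \<in> Q \<times> D. t \<le> (\<lambda>(l, d). rep (dil l) d) z}"
  define Z where "Z = real (card S)"
  have Z0: "Z \<ge> 0" by (simp add: Z_def)
  have finS: "finite S" using finD finQ by (simp add: S_def)
  define L where "L = (\<lambda>(l, d). (1 / l, - d)) ` S"
  have finL: "finite L" using finS by (simp add: L_def)
  have "card L = card S" unfolding L_def
    by (rule card_image) (auto simp: inj_on_def)
  then have cL: "real (card L) = Z" by (simp add: Z_def)
  have "card (SIGMA z:S. diff_pairs (dil (fst z)) (snd z)) \<le> card (incidences A A L)"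
  proof (rule card_inj_on_le[of "\<lambda>((l, d), (a, b)). (l * a, (1 / l, - d))"])
    show "inj_on (\<lambda>((l, d), (a, b)). (l * a, (1 / l, - d))) (SIGMA z:S. diff_pairs (dil (fst z)) (snd z))"
      using Q_nz by (auto simp: inj_on_def diff_pairs_def S_def)
    show "(\<lambda>((l, d), (a, b)). (l * a, (1 / l, - d))) ` (SIGMA z:S. diff_pairs (dil (fst z)) (snd z)) \<subseteq> incidences A A L"
      using Q_nz by (auto simp: incidences_def diff_pairs_def L_def S_def dilate_part_def)
    show "finite (incidences A A L)"
      by (rule finite_subset[of _ "A \<times> L"]) (use finA finL in \<open>auto simp: incidences_def\<close>)
  qed
  then have "real (card (SIGMA z:S. diff_pairs (dil (fst z)) (snd z))) \<le> real (card (incidences A A L))" by simp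
  also have "real (card (SIGMA z:S. diff_pairs (dil (fst z)) (snd z))) = (\<Sum>z\<in>S. rep (dil (fst z)) (snd z))"
    using finS finA by (simp add: card_SigmaI rep_def)
  finally have "(\<Sum>z\<in>S. rep (dil (fst z)) (snd z)) \<le> real (card (incidences A A L))" .
  moreover have "(\<Sum>z\<in>S. t) \<le> (\<Sum>z\<in>S. rep (dil (fst z)) (snd z))"
    by (intro sum_mono) (auto simp: S_def)
  ultimately have "t * Z \<le> real (card (incidences A A L))" by (simp add: Z_def mult_ac)
  then have "(t * Z) ^ 3 \<le> real (card (incidences A A L)) ^ 3"
    using assms by (intro power_mono) (auto simp: Z_def)
  also have "\<dots> \<le> 8000 * (n ^ 2 * n ^ 2 * Z ^ 2 + Z ^ 3)"
    unfolding cL[symmetric] n_def using finA finL Q_nz by (intro szemeredi_trotter_grid) (auto simp: L_def S_def)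
  finally have I: "t ^ 3 * Z ^ 3 \<le> 8000 * (n ^ 4 * Z ^ 2 + Z ^ 3)"
    by (simp add: power_mult_distrib flip: power_add)
  show ?thesis
  \<comment> \<open>For large \<open>t\<close> the linear term \<open>Z ^ 3\<close> is at most half
    of the left-hand side and can be absorbed there. For bounded \<open>t\<close> the trivial count
    \<open>Z <= n ^ 3\<close> suffices.\<close>
  proof (cases "t ^ 3 \<ge> 16000")
    case True
    have "16000 * Z ^ 3 \<le> t ^ 3 * Z ^ 3" using True Z0 by (intro mult_right_mono) auto
    then have I': "Z ^ 2 * (Z * t ^ 3) \<le> Z ^ 2 * (16000 * n ^ 4)"
      using I by (simp add: power_numeral_reduce mult_ac)
    have "Z * t ^ 3 \<le> 16000 * n ^ 4"
    proof (cases "Z = 0")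
      case False
      then show ?thesis using I' by simp
    qed simp
    then show ?thesis by (simp add: Z_def S_def)
  next
    case False
    have "Z = (\<Sum>z\<in>S. 1)" by (simp add: Z_def)
    also have "\<dots> \<le> (\<Sum>z\<in>S. rep (dil (fst z)) (snd z))"
      using assms by (intro sum_mono) (auto simp: S_def rep_def Suc_le_eq)
    also have "\<dots> \<le> (\<Sum>z\<in>Q \<times> D. rep (dil (fst z)) (snd z))"
      using finQ finD by (intro sum_mono2) (auto simp: S_def)
    also have "\<dots> \<le> n ^ 3" using sum_rep_dil[of Q] by (simp add: case_prod_beta)
    also have "\<dots> \<le> n ^ 4" using n2 by (intro power_increasing) auto
    finally have "Z * t ^ 3 \<le> n ^ 4 * 16000"
      using False assms Z0 by (intro mult_mono) auto
    then show ?thesis by (simp add: Z_def S_def)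
  qed
qed

lemma cubic_energy_bound: "(\<Sum>d\<in>D. r d ^ 3) \<le> 256000 * M ^ 2 * n ^ 3 * J"
proof -
  obtain k where k: "n < 2 ^ k" "real k \<le> 2 * J" by (rule dyadic_levels)
  \<comment> \<open>Representation counts are 0 or at least 1, so a window starting at 1 and
    exceeding \<open>n\<close> loses nothing.\<close>
  have "(\<Sum>d\<in>D. r d ^ 3) = (\<Sum>d\<in>{d \<in> D. 1 \<le> r d \<and> r d < 2 ^ k * 1}. r d ^ 3)"
    using finD rep_zero_or_ge1[of A] k(1)
    by (intro sum.mono_neutral_right) (auto intro: le_less_trans[OF r_le_n])
  also have "\<dots> \<le> 8 * (16000 * M ^ 2 * n ^ 3) * real k"
    by (intro dyadic_window_sum finD card_popular_differences) auto
  also have "\<dots> \<le> 8 * (16000 * M ^ 2 * n ^ 3) * (2 * J)"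
    using k(2) n_pos by (intro mult_left_mono) auto
  finally show ?thesis by simp
qed

lemma rich_lines_cubic_bound:
  assumes "S \<subseteq> Q" shows "(\<Sum>(l, d)\<in>S \<times> D. rep (dil l) d ^ 3) \<le> 256000 * n ^ 4 * J"
proof -
  obtain k where k: "n < 2 ^ k" "real k \<le> 2 * J" by (rule dyadic_levels)
  define f where "f = (\<lambda>(l, d). rep (dil l) d)"
  have f_lt: "f z < 2 ^ k * 1" for z
    using rep_le_card[OF fin_dil, of "fst z" "snd z"] card_dil_le[of "fst z"] k(1)
    unfolding f_def case_prod_beta by linarith
  have "(\<Sum>(l, d)\<in>S \<times> D. rep (dil l) d ^ 3) = (\<Sum>z\<in>S \<times> D. f z ^ 3)"
    by (simp add: f_def case_prod_beta)
  also have "\<dots> \<le> (\<Sum>z\<in>Q \<times> D. f z ^ 3)"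
    using finQ finD assms by (intro sum_mono2) (auto simp: f_def)
  also have "\<dots> = (\<Sum>z\<in>{z \<in> Q \<times> D. 1 \<le> f z \<and> f z < 2 ^ k * 1}. f z ^ 3)"
  proof (rule sum.mono_neutral_right)
    show "\<forall>z \<in> Q \<times> D - {z \<in> Q \<times> D. 1 \<le> f z \<and> f z < 2 ^ k * 1}. f z ^ 3 = 0"
      using f_lt rep_zero_or_ge1 by (fastforce simp: f_def case_prod_beta)
  qed (use finQ finD in auto)
  also have "\<dots> \<le> 8 * (16000 * n ^ 4) * real k"
    unfolding f_def using finQ finD by (intro dyadic_window_sum card_rich_lines) auto
  also have "\<dots> \<le> 8 * (16000 * n ^ 4) * (2 * J)"
    using k(2) n_pos by (intro mult_left_mono) auto
  finally show ?thesis by simp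
qed

text \<open>A representation \<open>d = a - b\<close> inside \<open>dil l\<close> reads
  \<open>d = (1 / l) * (l * a) - b\<close> with \<open>l * a\<close> in \<open>A\<close>: an
  incidence of \<open>A \<times> T\<close> with one of \<open>K\<close> lines.\<close>

lemma dilate_incidences:
  assumes S: "S \<subseteq> Q" and T: "T \<subseteq> D"
  defines "K \<equiv> (\<Sum>l\<in>S. real (card (dil l)))"
  shows "(\<Sum>l\<in>S. \<Sum>d\<in>T. rep (dil l) d) ^ 3 \<le> 8000 * (n ^ 2 * real (card T) ^ 2 * K ^ 2 + K ^ 3)"
proof -
  have finS: "finite S" and finT: "finite T" using S T finQ finD finite_subset by blast+
  define L where "L = (\<lambda>(l, b). (1 / l, - b)) ` (SIGMA l:S. dil l)"
  have finL: "finite L" using finS by (simp add: L_def)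
  have "card L = card (SIGMA l:S. dil l)" unfolding L_def
    by (rule card_image) (auto simp: inj_on_def)
  then have cL: "real (card L) = K" using finS by (simp add: card_SigmaI K_def)
  have "card (SIGMA l:S. SIGMA d:T. diff_pairs (dil l) d) \<le> card (incidences A T L)"
  proof (rule card_inj_on_le[of "\<lambda>(l, d, (a, b)). (l * a, (1 / l, - b))"])
    show "inj_on (\<lambda>(l, d, (a, b)). (l * a, (1 / l, - b))) (SIGMA l:S. SIGMA d:T. diff_pairs (dil l) d)"
      using Q_nz S by (auto simp: inj_on_def diff_pairs_def)
    have "l \<noteq> 0" if "l \<in> S" for l using that S Q_nz by auto
    then show "(\<lambda>(l, d, (a, b)). (l * a, (1 / l, - b))) ` (SIGMA l:S. SIGMA d:T. diff_pairs (dil l) d) \<subseteq> incidences A T L"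
      by (auto simp: incidences_def diff_pairs_def L_def dilate_part_def)
    show "finite (incidences A T L)"
      by (rule finite_subset[of _ "A \<times> L"]) (use finA finL in \<open>auto simp: incidences_def\<close>)
  qed
  then have "real (card (SIGMA l:S. SIGMA d:T. diff_pairs (dil l) d)) \<le> real (card (incidences A T L))" by simp
  also have "real (card (SIGMA l:S. SIGMA d:T. diff_pairs (dil l) d)) = (\<Sum>l\<in>S. \<Sum>d\<in>T. rep (dil l) d)"
    using finS finT by (simp add: card_SigmaI rep_def)
  finally have "(\<Sum>l\<in>S. \<Sum>d\<in>T. rep (dil l) d) ^ 3 \<le> real (card (incidences A T L)) ^ 3"
    by (intro power_mono sum_nonneg) auto
  also have "\<dots> \<le> 8000 * (n ^ 2 * real (card T) ^ 2 * K ^ 2 + K ^ 3)"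
    unfolding cL[symmetric] n_def using finA finT finL Q_nz S by (intro szemeredi_trotter_grid) (auto simp: L_def)
  finally show ?thesis .
qed

text \<open>Writing \<open>w = e * (a - b) = e * a - e * b\<close> with \<open>e * a, e * b\<close> in the product set, an averaging argument
  over pairs of products shows that for most \<open>(e, a, b)\<close> the element \<open>w\<close> lies in many of the sets \<open>e' * D\<close>;
  hence few such elements occur.\<close>

definition dilators :: "real \<Rightarrow> real set" where
  "dilators w = {e \<in> A. w / e \<in> D}"

definition popular_dilates :: "real \<Rightarrow> real set" where
  "popular_dilates k = {w. k \<le> real (card (dilators w))}"

definition common_divisors :: "real \<Rightarrow> real \<Rightarrow> real set" where
  "common_divisors p q = {e \<in> A. p / e \<in> A \<and> q / e \<in> A}"

text \<open>A quarter of \<open>n ^ 3 / P ^ 2 = n / M ^ 2\<close>, the average number of common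
  divisors of a pair of products.\<close>

definition k0 :: real where "k0 = n / (4 * M ^ 2)"

lemma k0_pos: "k0 > 0" using n_pos M1 by (simp add: k0_def)

lemma fin_dilators [simp]: "finite (dilators w)" using finA by (simp add: dilators_def)

lemma fin_common_divisors [simp]: "finite (common_divisors p q)" using finA by (simp add: common_divisors_def)

lemma common_divisors_subset: "common_divisors (e * a) (e * b) \<subseteq> dilators (e * (a - b))"
  by (auto simp: common_divisors_def dilators_def right_diff_distrib diff_divide_distrib intro: diffI)

text \<open>Double counting: the pairs \<open>(w, e)\<close> with \<open>e\<close> in
  \<open>dilators w\<close> inject into \<open>A \<times> D\<close> by
  \<open>(e, w / e)\<close>.\<close>

lemma popular_dilates_bound:
  assumes "k > 0"
  shows "finite (popular_dilates k)" "real (card (popular_dilates k)) * k \<le> n * \<delta>"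
proof -
  have "popular_dilates k \<subseteq> (\<lambda>(e, x). e * x) ` (A \<times> D)"
  proof
    fix w assume "w \<in> popular_dilates k"
    then have "dilators w \<noteq> {}" using assms by (auto simp: popular_dilates_def)
    then obtain e where e: "e \<in> A" "w / e \<in> D" by (auto simp: dilators_def)
    then show "w \<in> (\<lambda>(e, x). e * x) ` (A \<times> D)"
      using nz by (intro image_eqI[of _ _ "(e, w / e)"]) auto
  qed
  then show fin: "finite (popular_dilates k)" using finA finD finite_subset by blast
  have "real (card (popular_dilates k)) * k \<le> (\<Sum>w\<in>popular_dilates k. real (card (dilators w)))"
    by (rule sum_bounded_below) (auto simp: popular_dilates_def)
  also have "\<dots> = real (card (SIGMA w:popular_dilates k. dilators w))"
    using fin by (simp add: card_SigmaI)
  also have "card (SIGMA w:popular_dilates k. dilators w) \<le> card (A \<times> D)"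
    by (rule card_inj_on_le[of "\<lambda>(w, e). (e, w / e)"])
       (use finA finD nz in \<open>auto simp: inj_on_def dilators_def\<close>)
  finally show "real (card (popular_dilates k)) * k \<le> n * \<delta>" by (simp add: n_def \<delta>_def card_cartesian_product)
qed

text \<open>A triple is recovered from \<open>(e * a, e * b)\<close> and the common divisor
  \<open>e\<close>. Hence the at most \<open>P ^ 2\<close> pairs of products with fewer than
  \<open>k0\<close> common divisors account for at most \<open>P ^ 2 * k0 = n ^ 3 / 4\<close>
  triples.\<close>

lemma popular_triples:
  "real (card {(e, a, b). e \<in> A \<and> a \<in> A \<and> b \<in> A \<and> k0 \<le> real (card (common_divisors (e * a) (e * b)))})
    \<ge> 3 / 4 * n ^ 3"
proof -
  let ?g = "{(e, a, b). e \<in> A \<and> a \<in> A \<and> b \<in> A \<and> k0 \<le> real (card (common_divisors (e * a) (e * b)))}"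
  define T where "T = {(e, a, b). e \<in> A \<and> a \<in> A \<and> b \<in> A \<and> real (card (common_divisors (e * a) (e * b))) < k0}"
  define U where "U = {(p, q). p \<in> AA \<and> q \<in> AA \<and> real (card (common_divisors p q)) < k0}"
  have fins: "finite ?g" "finite T"
    by (rule finite_subset[of _ "A \<times> A \<times> A"]; use finA in \<open>auto simp: T_def\<close>)+
  have finU: "finite U" by (rule finite_subset[of _ "AA \<times> AA"]) (use finAA in \<open>auto simp: U_def\<close>)
  have "card T \<le> card (SIGMA z:U. common_divisors (fst z) (snd z))"
    by (rule card_inj_on_le[of "\<lambda>(e, a, b). ((e * a, e * b), e)"])
       (use nz finU in \<open>auto simp: T_def U_def inj_on_def intro: prodI\<close>,
        auto simp: common_divisors_def)
  also have "\<dots> = (\<Sum>z\<in>U. card (common_divisors (fst z) (snd z)))"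
    using finU by (simp add: card_SigmaI)
  finally have "real (card T) \<le> (\<Sum>z\<in>U. real (card (common_divisors (fst z) (snd z))))"
    by (metis of_nat_mono of_nat_sum)
  also have "\<dots> \<le> (\<Sum>z\<in>U. k0)" by (intro sum_mono) (auto simp: U_def)
  also have "\<dots> = real (card U) * k0" by simp
  also have "\<dots> \<le> P ^ 2 * k0"
  proof -
    have "card U \<le> card (AA \<times> AA)" by (rule card_mono) (use finAA in \<open>auto simp: U_def\<close>)
    then have "real (card U) \<le> P ^ 2"
      by (simp add: P_def card_cartesian_product power2_eq_square flip: of_nat_mult)
    then show ?thesis using k0_pos by (intro mult_right_mono) auto
  qed
  also have "\<dots> = n ^ 3 / 4"
    using M1 by (simp add: k0_def P_eq power_mult_distrib power_numeral_reduce)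
  finally have T: "real (card T) \<le> n ^ 3 / 4" .
  have "card (A \<times> A \<times> A) = card (?g \<union> T)"
    by (rule arg_cong[of _ _ card]) (auto simp: T_def)
  also have "\<dots> \<le> card ?g + card T" by (rule card_Un_le)
  finally have "n ^ 3 \<le> real (card ?g) + real (card T)"
    by (simp add: n_def card_cartesian_product power_numeral_reduce flip: of_nat_mult of_nat_add)
  then show ?thesis using T by linarith
qed

end

section \<open>Dilates of the difference set\<close>

context nonzero_set
begin

text \<open>The third difference \<open>c - b\<close> is the difference of the two recorded ones, so
  all pairwise differences are known up to sign; only a common translation is forgotten.\<close>

abbreviation diff_shape :: "'i \<times> real \<times> real \<times> real \<Rightarrow> 'i \<times> real \<times> real" where
  "diff_shape \<equiv> (\<lambda>(i, a, b, c). (i, a - b, a - c))"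

text \<open>An image \<open>(e, x, y)\<close> has \<open>e * x\<close> in
  \<open>popular_dilates k\<close>, of size at most \<open>n * \<delta> / k\<close>, and
  \<open>y\<close> in \<open>S\<close>; \<open>dilation_incidences\<close> applies.\<close>

lemma shape_bound:
  assumes k: "k > 0" and S: "finite S"
    and \<Omega>: "\<And>e a b c. (e, a, b, c) \<in> \<Omega> \<Longrightarrow>
      e \<in> A \<and> a \<in> A \<and> b \<in> A \<and> c \<in> A \<and> e * (a - b) \<in> popular_dilates k \<and> a - c \<in> S"
  shows "real (card (diff_shape ` \<Omega>)) ^ 3 \<le>
    8000 * ((n * \<delta> / k) ^ 2 * real (card S) ^ 2 * (n * \<delta>) ^ 2 + (n * \<delta>) ^ 3)"
proof -
  have "real (card (diff_shape ` \<Omega>)) ^ 3 \<le>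
    8000 * (real (card (popular_dilates k)) ^ 2 * real (card S) ^ 2 * (real (card A) * \<delta>) ^ 2
      + (real (card A) * \<delta>) ^ 3)"
  proof (rule dilation_incidences[OF finA _ S nz])
    show "finite (popular_dilates k)" by (rule popular_dilates_bound[OF k])
    fix e x y assume "(e, x, y) \<in> diff_shape ` \<Omega>"
    then obtain a b c where z: "(e, a, b, c) \<in> \<Omega>" "x = a - b" "y = a - c" by auto
    have "x - y = c - b" by (simp add: z)
    then show "e \<in> A \<and> e * x \<in> popular_dilates k \<and> y \<in> S \<and> x - y \<in> D"
      using \<Omega>[OF z(1)] z by (simp add: diffI)
  qed
  also have "real (card (popular_dilates k)) ^ 2 \<le> (n * \<delta> / k) ^ 2"
    using popular_dilates_bound(2)[OF k] k by (intro power_mono) (auto simp: pos_le_divide_eq)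
  finally show ?thesis by (simp add: n_def mult_right_mono)
qed

text \<open>The case \<open>S = D\<close>, where \<open>k <= n <= \<delta>\<close> makes the linear
  term harmless. A larger popularity level \<open>k\<close> gives fewer shapes.\<close>

lemma shape_bound_D:
  assumes k: "k > 0" "k \<le> n"
    and \<Omega>: "\<And>e a b c. (e, a, b, c) \<in> \<Omega> \<Longrightarrow>
      e \<in> A \<and> a \<in> A \<and> b \<in> A \<and> c \<in> A \<and> e * (a - b) \<in> popular_dilates k"
  shows "real (card (diff_shape ` \<Omega>)) ^ 3 * k ^ 2 \<le> 16000 * (n ^ 4 * \<delta> ^ 6)"
proof -
  have \<delta>0: "\<delta> \<ge> n" "\<delta> > 0" using n_le_\<delta> n_pos by auto
  have 1: "real (card (diff_shape ` \<Omega>)) ^ 3 \<le>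
    8000 * ((n * \<delta> / k) ^ 2 * real (card D) ^ 2 * (n * \<delta>) ^ 2 + (n * \<delta>) ^ 3)"
    using \<Omega> by (intro shape_bound[OF k(1) finD]) (metis diffI)
  have "k ^ 2 * 1 \<le> n ^ 2 * (n * \<delta>)"
    using k n2 n_le_\<delta> by (intro mult_mono power_mono mult_ge1_I) auto
  also have "\<dots> = n * (n * n) * \<delta>" by (simp add: power2_eq_square)
  also have "\<dots> \<le> n * (\<delta> * \<delta>) * \<delta>"
    using \<delta>0 n_pos by (intro mult_right_mono mult_left_mono mult_mono) auto
  finally have "(n * \<delta>) ^ 3 * k ^ 2 \<le> (n * \<delta>) ^ 3 * (n * \<delta> ^ 3)"
    using \<delta>0 n_pos by (intro mult_left_mono) (auto simp: power3_eq_cube mult_ac)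
  also have "\<dots> = n ^ 4 * \<delta> ^ 6" by (simp add: power_mult_distrib power_numeral_reduce)
  finally have 2: "(n * \<delta>) ^ 3 * k ^ 2 \<le> n ^ 4 * \<delta> ^ 6" .
  have "real (card (diff_shape ` \<Omega>)) ^ 3 * k ^ 2 \<le>
      8000 * ((n * \<delta> / k) ^ 2 * real (card D) ^ 2 * (n * \<delta>) ^ 2 + (n * \<delta>) ^ 3) * k ^ 2"
    using 1 by (intro mult_right_mono) auto
  also have "\<dots> = 8000 * (n ^ 4 * \<delta> ^ 6 + (n * \<delta>) ^ 3 * k ^ 2)"
    using k unfolding \<delta>_def[symmetric]
    by (simp add: power_divide power_mult_distrib power_numeral_reduce field_simps)
  finally show ?thesis using 2 by (rule absorb_lower_term)
qed

text \<open>The lower bound for the number of shapes: \<open>translation_energy\<close> with all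
  sets equal to \<open>A\<close> reduces the coincidences to the cubic energy, once for each
  \<open>e\<close>.\<close>

lemma shape_energy:
  assumes \<Omega>: "\<And>e a b c. (e, a, b, c) \<in> \<Omega> \<Longrightarrow> e \<in> A \<and> a \<in> A \<and> b \<in> A \<and> c \<in> A"
  shows "real (card \<Omega>) ^ 2 \<le> real (card (diff_shape ` \<Omega>)) * (256000 * M ^ 2 * n ^ 4 * J)"
proof -
  define Z where "Z = real (card (diff_shape ` \<Omega>))"
  have "real (card \<Omega>) ^ 2 \<le> Z * (\<Sum>e\<in>A. \<Sum>d\<in>D. r d * real (card {((a, a'), (c, c')).
      (a, a') \<in> diff_pairs A d \<and> (c, c') \<in> diff_pairs A d \<and> True}))"
    unfolding Z_def
    by (rule translation_energy[where Pr = "\<lambda>_. True"]) (use finA finD \<Omega> in \<open>auto intro: diffI\<close>)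
  also have "\<dots> \<le> Z * (\<Sum>e\<in>A. \<Sum>d\<in>D. r d * (r d * r d))"
    using card_pair_coincidences_le[OF finA finA, of _ "\<lambda>_. True"]
    by (intro mult_left_mono sum_mono) (auto simp: Z_def)
  also have "(\<Sum>e\<in>A. \<Sum>d\<in>D. r d * (r d * r d)) = n * (\<Sum>d\<in>D. r d ^ 3)"
    by (simp add: n_def power3_eq_cube mult_ac)
  also have "\<dots> \<le> n * (256000 * M ^ 2 * n ^ 3 * J)"
    using cubic_energy_bound n_pos by (intro mult_left_mono) auto
  also have "\<dots> = 256000 * M ^ 2 * n ^ 4 * J" by (simp add: power_numeral_reduce)
  finally show ?thesis by (simp add: Z_def mult_left_mono)
qed

lemma k0_le_n: "k0 \<le> n"
proof -
  have "4 * M ^ 2 \<ge> 1" using M1 one_le_power[OF M1, of 2] by linarith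
  then show ?thesis unfolding k0_def using n_pos by (simp add: divide_le_eq mult_le_cancel_left1)
qed

text \<open>The number of coincidences of \<open>(e, e', a - b, a - c)\<close> over \<open>e, e', c \<in> A\<close> and \<open>a, b \<in> dil (e / e')\<close>.\<close>

definition W :: real where
  "W = (\<Sum>l\<in>Q. real (card (dil l)) * (\<Sum>d\<in>D. rep (dil l) d ^ 2 * r d))"

section \<open>Large doubling: triples with many and with few common dilators\<close>

lemma sum_ratio_eq: "(\<Sum>(e, e')\<in>A \<times> A. f (e / e')) = (\<Sum>l\<in>Q. real (card (dil l)) * f l)"
proof -
  have "(\<Sum>(e, e')\<in>A \<times> A. f (e / e')) = (\<Sum>(l, a)\<in>(SIGMA l:Q. dil l). f l)"
    by (rule sum.reindex_bij_witness[of _ "\<lambda>(l, a). (l * a, a)" "\<lambda>(e, e'). (e / e', e')"])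
       (use nz in \<open>auto simp: Q_def dilate_part_def\<close>)
  also have "\<dots> = (\<Sum>l\<in>Q. \<Sum>a\<in>dil l. f l)" using finQ by (subst sum.Sigma) auto
  finally show ?thesis by simp
qed

text \<open>Raising the popularity level from \<open>k0\<close> to \<open>J * k0\<close> gains
  \<open>J ^ 2\<close> in \<open>shape_bound_D\<close>. The cubed energy bound costs
  \<open>J ^ 3\<close>, so a single factor \<open>J\<close> remains.\<close>

lemma many_common_dilators:
  assumes T: "T \<subseteq> A \<times> A \<times> A" "real (card T) \<ge> n ^ 3 / 4"
    and pop: "\<And>e a b. (e, a, b) \<in> T \<Longrightarrow> e * (a - b) \<in> popular_dilates (J * k0)"
  shows "n ^ 10 \<le> 16 * (4 ^ 6 * 16000 * 256000 ^ 3) * (\<delta> ^ 6 * M ^ 10 * J)"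
proof -
  define k where "k = J * k0"
  have k: "k > 0" using J1 k0_pos by (simp add: k_def)
  define \<Omega> where "\<Omega> = (\<lambda>((e, a, b), c). (e, a, b, c)) ` (T \<times> A)"
  have c\<Omega>: "real (card \<Omega>) = real (card T) * n"
    unfolding \<Omega>_def n_def by (subst card_image) (auto simp: inj_on_def card_cartesian_product)
  have \<Omega>: "e \<in> A \<and> a \<in> A \<and> b \<in> A \<and> c \<in> A \<and> e * (a - b) \<in> popular_dilates k"
    if "(e, a, b, c) \<in> \<Omega>" for e a b c
    using that T(1) pop by (auto simp: \<Omega>_def k_def)
  have "k \<le> n"
  proof -
    have "T \<noteq> {}" using T(2) n_pos by (auto simp: not_le)
    then obtain e a b where "(e, a, b) \<in> T" by auto
    then have "k \<le> real (card (dilators (e * (a - b))))"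
      using pop by (auto simp: popular_dilates_def k_def)
    also have "\<dots> \<le> n" unfolding n_def
      by (intro of_nat_mono card_mono finA) (auto simp: dilators_def)
    finally show ?thesis .
  qed
  define Z where "Z = real (card (diff_shape ` \<Omega>))"
  have Z: "Z ^ 3 * k ^ 2 \<le> 16000 * (n ^ 4 * \<delta> ^ 6)"
    unfolding Z_def by (rule shape_bound_D[OF k \<open>k \<le> n\<close> \<Omega>])
  have "real (card \<Omega>) ^ 2 \<le> Z * (256000 * M ^ 2 * n ^ 4 * J)"
    unfolding Z_def using \<Omega> by (intro shape_energy) blast
  moreover have "n ^ 4 / 4 \<le> real (card \<Omega>)"
    unfolding c\<Omega> using T(2) n_pos by (simp add: power_numeral_reduce mult_right_mono)
  then have "(n ^ 4 / 4) ^ 2 \<le> real (card \<Omega>) ^ 2" using n_pos by (intro power_mono) auto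
  ultimately have "(n ^ 4 / 4) ^ 2 \<le> Z * (256000 * M ^ 2 * n ^ 4 * J)" by (rule order_trans[rotated])
  then have "((n ^ 4 / 4) ^ 2) ^ 3 \<le> (Z * (256000 * M ^ 2 * n ^ 4 * J)) ^ 3"
    using n_pos by (intro power_mono) auto
  then have "n ^ 24 / 4 ^ 6 \<le> Z ^ 3 * (256000 ^ 3 * M ^ 6 * n ^ 12 * J ^ 3)"
    by (simp add: power_divide power_mult_distrib flip: power_mult)
  then have "n ^ 24 / 4 ^ 6 * k ^ 2 \<le> (Z ^ 3 * (256000 ^ 3 * M ^ 6 * n ^ 12 * J ^ 3)) * k ^ 2"
    by (intro mult_right_mono) auto
  also have "\<dots> = (Z ^ 3 * k ^ 2) * (256000 ^ 3 * M ^ 6 * n ^ 12 * J ^ 3)" by (simp add: mult_ac)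
  also have "\<dots> \<le> 16000 * (n ^ 4 * \<delta> ^ 6) * (256000 ^ 3 * M ^ 6 * n ^ 12 * J ^ 3)"
    using J1 n_pos M1 by (intro mult_right_mono[OF Z]) auto
  finally have "n ^ 24 / 4 ^ 6 * k ^ 2 \<le> 16000 * (n ^ 4 * \<delta> ^ 6) * (256000 ^ 3 * M ^ 6 * n ^ 12 * J ^ 3)" .
  also have "n ^ 24 / 4 ^ 6 * k ^ 2 = (n ^ 16 * J ^ 2) * (n ^ 10 / (16 * 4 ^ 6 * M ^ 4))"
    unfolding k_def k0_def using M1 n_pos
    by (simp add: power_divide power_mult_distrib flip: power_mult power_add)
  also have "16000 * (n ^ 4 * \<delta> ^ 6) * (256000 ^ 3 * M ^ 6 * n ^ 12 * J ^ 3)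
      = (n ^ 16 * J ^ 2) * (16000 * 256000 ^ 3 * \<delta> ^ 6 * M ^ 6 * J)"
    by (simp add: power_numeral_reduce)
  finally have "n ^ 10 / (16 * 4 ^ 6 * M ^ 4) \<le> 16000 * 256000 ^ 3 * \<delta> ^ 6 * M ^ 6 * J"
    using n_pos J1 by (subst (asm) mult_le_cancel_left_pos) auto
  then show ?thesis using M1 by (simp add: divide_le_eq power_numeral_reduce mult_ac)
qed

text \<open>Each triple is extended by a common divisor \<open>e'\<close>, which places
  \<open>a\<close> and \<open>b\<close> in \<open>dil (e / e')\<close>, so that the energy becomes
  \<open>W\<close>. As every shape admits at most \<open>J * k0\<close> values \<open>e'\<close>,
  the extension multiplies the number of shapes by at most that; the bound on \<open>W\<close>
  cancels the factor \<open>J\<close>.\<close>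

lemma few_common_dilators:
  assumes T: "T \<subseteq> A \<times> A \<times> A" "real (card T) \<ge> n ^ 3 / 2"
    and pop: "\<And>e a b. (e, a, b) \<in> T \<Longrightarrow> k0 \<le> real (card (common_divisors (e * a) (e * b)))"
    and few: "\<And>e a b. (e, a, b) \<in> T \<Longrightarrow> real (card (dilators (e * (a - b)))) \<le> J * k0"
    and W: "W \<le> n ^ 5 / J"
  shows "n ^ 10 \<le> (64 * 16000 * 1024) * (\<delta> ^ 6 * M ^ 10)"
proof -
  have finT: "finite T" using T(1) finA finite_subset by blast
  define \<Omega>4 where "\<Omega>4 = (\<lambda>((e, a, b), c). (e, a, b, c)) ` (T \<times> A)"
  define \<Omega> where "\<Omega> = (\<lambda>(((e, a, b), e'), c). ((e, e'), a, b, c)) `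
    ((SIGMA t:T. case t of (e, a, b) \<Rightarrow> common_divisors (e * a) (e * b)) \<times> A)"
  have fin1: "finite (SIGMA t:T. case t of (e, a, b) \<Rightarrow> common_divisors (e * a) (e * b))"
    using finT by (intro finite_SigmaI) auto
  have fin\<Omega>: "finite \<Omega>" unfolding \<Omega>_def using fin1 finA by auto
  have fin\<Omega>4: "finite \<Omega>4" unfolding \<Omega>4_def using finT finA by auto
  have "real (card \<Omega>) = real (card (SIGMA t:T. case t of (e, a, b) \<Rightarrow> common_divisors (e * a) (e * b))) * n"
    unfolding \<Omega>_def n_def by (subst card_image) (auto simp: inj_on_def card_cartesian_product)
  also have "real (card (SIGMA t:T. case t of (e, a, b) \<Rightarrow> common_divisors (e * a) (e * b)))
    = (\<Sum>t\<in>T. real (card (case t of (e, a, b) \<Rightarrow> common_divisors (e * a) (e * b))))"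
    using finT by (subst card_SigmaI) auto
  finally have "real (card \<Omega>) = (\<Sum>t\<in>T. real (card (case t of (e, a, b) \<Rightarrow> common_divisors (e * a) (e * b)))) * n" .
  moreover have "real (card T) * k0 \<le> (\<Sum>t\<in>T. real (card (case t of (e, a, b) \<Rightarrow> common_divisors (e * a) (e * b))))"
    using pop by (intro sum_bounded_below) auto
  moreover have "n ^ 3 / 2 * k0 \<le> real (card T) * k0" using T(2) k0_pos by (intro mult_right_mono) auto
  ultimately have c\<Omega>: "n ^ 3 / 2 * k0 * n \<le> real (card \<Omega>)"
    using n_pos by (smt (verit) mult_right_mono)
  have \<Omega>4I: "(e, a, b, c) \<in> \<Omega>4" if "(e, a, b) \<in> T" "c \<in> A" for e a b c
    using that unfolding \<Omega>4_def by (intro image_eqI[of _ _ "((e, a, b), c)"]) auto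
  have \<Omega>: "fst i \<in> A \<and> snd i \<in> A \<and> a \<in> dil (fst i / snd i) \<and> b \<in> dil (fst i / snd i) \<and> c \<in> A
      \<and> (fst i, a, b, c) \<in> \<Omega>4 \<and> (fst i, a, b) \<in> T \<and> snd i \<in> common_divisors (fst i * a) (fst i * b)"
    if "(i, a, b, c) \<in> \<Omega>" for i a b c
    using that T(1) unfolding \<Omega>_def
    by (auto simp: common_divisors_def dilate_part_def intro: \<Omega>4I)
  have \<Omega>4: "e \<in> A \<and> a \<in> A \<and> b \<in> A \<and> c \<in> A \<and> e * (a - b) \<in> popular_dilates k0"
    if "(e, a, b, c) \<in> \<Omega>4" for e a b c
  proof -
    have t: "(e, a, b) \<in> T" "c \<in> A" using that by (auto simp: \<Omega>4_def)
    have "card (common_divisors (e * a) (e * b)) \<le> card (dilators (e * (a - b)))"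
      using common_divisors_subset by (intro card_mono) auto
    then show ?thesis using t T(1) pop[OF t(1)] by (auto simp: popular_dilates_def)
  qed
  define Z where "Z = real (card (diff_shape ` \<Omega>4))"
  have Z0: "Z \<ge> 0" by (simp add: Z_def)
  have Z: "Z ^ 3 * k0 ^ 2 \<le> 16000 * (n ^ 4 * \<delta> ^ 6)"
    unfolding Z_def by (rule shape_bound_D[OF k0_pos k0_le_n \<Omega>4])
  \<comment> \<open>The possible \<open>e'\<close> depend on the shape alone: a common divisor of
    \<open>e * a\<close> and \<open>e * b\<close> is a dilator of
    \<open>e * (a - b)\<close>.\<close>
  have "card (diff_shape ` \<Omega>) \<le> card (SIGMA z:diff_shape ` \<Omega>4. dilators (fst z * fst (snd z)))"
  proof (rule card_inj_on_le[of "\<lambda>((e, e'), x, y). ((e, x, y), e')"])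
    show "inj_on (\<lambda>((e, e'), x, y). ((e, x, y), e')) (diff_shape ` \<Omega>)" by (auto simp: inj_on_def)
    have "((e, a - b, a - c), e') \<in> (SIGMA z:diff_shape ` \<Omega>4. dilators (fst z * fst (snd z)))"
      if "((e, e'), a, b, c) \<in> \<Omega>" for e e' a b c
    proof -
      from \<Omega>[OF that] have "(e, a, b, c) \<in> \<Omega>4" "e' \<in> common_divisors (e * a) (e * b)" by auto
      then show ?thesis
        using common_divisors_subset by (auto simp: image_iff intro!: bexI[of _ "(e, a, b, c)"])
    qed
    then show "(\<lambda>((e, e'), x, y). ((e, x, y), e')) ` (diff_shape ` \<Omega>)
      \<subseteq> (SIGMA z:diff_shape ` \<Omega>4. dilators (fst z * fst (snd z)))" by auto
  qed (use fin\<Omega>4 in auto)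
  also have "\<dots> = (\<Sum>z\<in>diff_shape ` \<Omega>4. card (dilators (fst z * fst (snd z))))"
    using fin\<Omega>4 by (intro card_SigmaI) auto
  finally have "real (card (diff_shape ` \<Omega>)) \<le> (\<Sum>z\<in>diff_shape ` \<Omega>4. real (card (dilators (fst z * fst (snd z)))))"
    unfolding of_nat_sum[symmetric] of_nat_le_iff .
  also have "\<dots> \<le> (\<Sum>z\<in>diff_shape ` \<Omega>4. J * k0)"
    by (intro sum_mono) (auto simp: \<Omega>4_def few)
  finally have Z5: "real (card (diff_shape ` \<Omega>)) \<le> Z * (J * k0)" by (simp add: Z_def)
  have "real (card \<Omega>) ^ 2 \<le> real (card (diff_shape ` \<Omega>)) * (\<Sum>i\<in>A \<times> A. \<Sum>d\<in>D.
      rep (dil (fst i / snd i)) d * real (card {((a, a'), (c, c')).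
      (a, a') \<in> diff_pairs (dil (fst i / snd i)) d \<and> (c, c') \<in> diff_pairs A d \<and> True}))"
    by (rule translation_energy[where Pr = "\<lambda>_. True"])
       (use finA finD \<Omega> in \<open>auto intro!: diffI intro: subsetD[OF dil_subset] simp: mem_Times_iff\<close>)
  also have "\<dots> \<le> (Z * (J * k0)) * (\<Sum>i\<in>A \<times> A. \<Sum>d\<in>D.
      rep (dil (fst i / snd i)) d * (rep (dil (fst i / snd i)) d * r d))"
    using card_pair_coincidences_le[OF fin_dil finA, of _ _ "\<lambda>_. True"] Z0 J1 k0_pos
    by (intro mult_mono Z5 sum_mono mult_left_mono sum_nonneg) auto
  also have "(\<Sum>i\<in>A \<times> A. \<Sum>d\<in>D. rep (dil (fst i / snd i)) d * (rep (dil (fst i / snd i)) d * r d)) = W"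
    unfolding W_def sum_ratio_eq[symmetric] by (simp add: case_prod_beta power2_eq_square mult_ac)
  also have "(Z * (J * k0)) * W \<le> (Z * (J * k0)) * (n ^ 5 / J)"
    using Z0 J1 k0_pos W by (intro mult_left_mono) auto
  also have "\<dots> = Z * k0 * n ^ 5" using J1 by simp
  finally have 1: "real (card \<Omega>) ^ 2 \<le> Z * k0 * n ^ 5" .
  have "(n ^ 4 * k0 / 2) ^ 2 \<le> real (card \<Omega>) ^ 2"
    using c\<Omega> n_pos k0_pos by (intro power_mono) (auto simp: power_numeral_reduce mult_ac)
  then have "(n ^ 5 * k0) * (n ^ 3 * k0 / 4) \<le> (n ^ 5 * k0) * Z"
    using 1 by (simp add: power_divide power_mult_distrib power_numeral_reduce mult_ac)
  then have "n ^ 3 * k0 / 4 \<le> Z"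
    using n_pos k0_pos by (subst (asm) mult_le_cancel_left_pos) auto
  then have "(n ^ 3 * k0 / 4) ^ 3 * k0 ^ 2 \<le> Z ^ 3 * k0 ^ 2"
    using n_pos k0_pos by (intro mult_right_mono power_mono) auto
  also note Z
  finally have "n ^ 4 * (n ^ 5 * k0 ^ 5 / 64) \<le> n ^ 4 * (16000 * \<delta> ^ 6)"
    by (simp add: power_divide power_mult_distrib power_numeral_reduce mult_ac)
  then have "n ^ 5 * k0 ^ 5 / 64 \<le> 16000 * \<delta> ^ 6"
    using n_pos by (subst (asm) mult_le_cancel_left_pos) auto
  then have "n ^ 10 / (64 * 1024 * M ^ 10) \<le> 16000 * \<delta> ^ 6"
    unfolding k0_def by (simp add: power_divide power_mult_distrib mult_ac flip: power_mult power_add)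
  then show ?thesis using M1 by (simp add: divide_le_eq mult_ac)
qed

text \<open>The popular triples are split according to whether \<open>e * (a - b)\<close> has at
  least or at most \<open>J * k0\<close> dilators.\<close>

lemma large_doubling_case:
  assumes "W \<le> n ^ 5 / J"
  shows "n ^ 10 \<le> 16 * (4 ^ 6 * 16000 * 256000 ^ 3) * (\<delta> ^ 6 * M ^ 10 * J)"
proof -
  define G where "G = {(e, a, b). e \<in> A \<and> a \<in> A \<and> b \<in> A \<and> k0 \<le> real (card (common_divisors (e * a) (e * b)))}"
  define G1 where "G1 = {(e, a, b) \<in> G. J * k0 \<le> real (card (dilators (e * (a - b))))}"
  define G2 where "G2 = {(e, a, b) \<in> G. real (card (dilators (e * (a - b)))) \<le> J * k0}"
  have sub: "G \<subseteq> A \<times> A \<times> A" by (auto simp: G_def)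
  then have finG: "finite G" using finA finite_subset by blast
  have "G1 \<subseteq> G" "G2 \<subseteq> G" by (auto simp: G1_def G2_def)
  then have "finite G1" "finite G2" using finG finite_subset by blast+
  then have "card G \<le> card (G1 \<union> G2)"
    by (intro card_mono) (auto simp: G1_def G2_def)
  also have "\<dots> \<le> card G1 + card G2" by (rule card_Un_le)
  finally have "real (card G) \<le> real (card G1) + real (card G2)" by simp
  then have "3 / 4 * n ^ 3 \<le> real (card G1) + real (card G2)" using popular_triples by (simp add: G_def)
  \<comment> \<open>The three quarters of all triples are shared out as a quarter and a half, as the
    two cases require.\<close>
  then consider "real (card G1) \<ge> n ^ 3 / 4" | "real (card G2) \<ge> n ^ 3 / 2" by linarith
  then show ?thesis
  proof cases
    case 1
    show ?thesis
      by (rule many_common_dilators[OF _ 1]) (use sub in \<open>auto simp: G1_def popular_dilates_def\<close>)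
  next
    case 2
    have "n ^ 10 \<le> (64 * 16000 * 1024) * (\<delta> ^ 6 * M ^ 10)"
      by (rule few_common_dilators[OF _ 2 _ _ assms]) (use sub in \<open>auto simp: G2_def G_def\<close>)
    also have "\<dots> \<le> (64 * 16000 * 1024) * (\<delta> ^ 6 * M ^ 10 * J)"
      using mult_left_mono[OF J1, of "\<delta> ^ 6 * M ^ 10"] M1 by simp
    also have "\<dots> \<le> 16 * (4 ^ 6 * 16000 * 256000 ^ 3) * (\<delta> ^ 6 * M ^ 10 * J)"
      using J1 M1 by (intro mult_right_mono) auto
    finally show ?thesis .
  qed
qed

end

section \<open>The mixed energy for large doubling\<close>

definition dyadic_level :: "real \<Rightarrow> nat" where "dyadic_level x = nat \<lfloor>log 2 x\<rfloor>"

lemma dyadic_level: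
  assumes "x \<ge> 1"
  shows "2 ^ dyadic_level x \<le> x" "x \<le> 2 ^ (dyadic_level x + 1)" "x < 2 ^ k \<Longrightarrow> dyadic_level x < k"
proof -
  have l0: "log 2 x \<ge> 0" using assms by simp
  have eq: "real (dyadic_level x) = of_int \<lfloor>log 2 x\<rfloor>" using l0 by (simp add: dyadic_level_def)
  have x: "x = 2 powr (log 2 x)" using assms by simp
  have "2 powr (real (dyadic_level x)) \<le> 2 powr (log 2 x)" unfolding eq by simp
  then show 1: "2 ^ dyadic_level x \<le> x" using x by (simp add: powr_realpow)
  have "log 2 x \<le> real (dyadic_level x + 1)" unfolding of_nat_add eq by simp
  then have "2 powr (log 2 x) \<le> 2 powr (real (dyadic_level x + 1))" by simp
  also have "\<dots> = 2 ^ (dyadic_level x + 1)" by (subst powr_realpow) auto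
  finally show "x \<le> 2 ^ (dyadic_level x + 1)" using x by simp
  assume "x < 2 ^ k"
  then have "(2::real) ^ dyadic_level x < 2 ^ k" using 1 by linarith
  then show "dyadic_level x < k" by simp
qed

lemma sum_cube_le:
  fixes g :: "nat \<Rightarrow> real"
  assumes "\<And>j. j < k \<Longrightarrow> 0 \<le> g j" "\<And>j. j < k \<Longrightarrow> g j ^ 3 \<le> Z"
  shows "(\<Sum>j<k. g j) ^ 3 \<le> real k ^ 3 * Z"
proof (cases "k = 0")
  case False
  have Z: "Z \<ge> 0" using assms[of 0] False zero_le_power[of "g 0" 3] by linarith
  have "g j \<le> root 3 Z" if "j < k" for j
    using assms(2)[OF that] by (metis odd_numeral odd_real_root_power_cancel real_root_le_iff zero_less_numeral)
  then have "(\<Sum>j<k. g j) \<le> real k * root 3 Z"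
    using sum_bounded_above[of "{..<k}" g "root 3 Z"] by simp
  then have "(\<Sum>j<k. g j) ^ 3 \<le> (real k * root 3 Z) ^ 3"
    using assms(1) by (intro power_mono sum_nonneg) auto
  also have "\<dots> = real k ^ 3 * Z" using Z by (simp add: power_mult_distrib)
  finally show ?thesis .
qed simp

text \<open>\<open>CB\<close> and \<open>CW\<close> abbreviate the constants of
  \<open>dilation_level_bound\<close> and \<open>level_mixed_energy\<close>.\<close>

definition CB :: real where "CB = 16000 * 256000 ^ 3"
definition CW :: real where "CW = 64 * 256000 ^ 3 * (4096000 * 1024000008)"

lemma CB_CW_pos: "CB > 0" "CW > 0" by (simp_all add: CB_def CW_def)

context nonzero_set
begin

lemma r_ge1: "d \<in> D \<Longrightarrow> 1 \<le> r d"
proof -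
  assume "d \<in> D"
  then obtain a b where "(a, b) \<in> diff_pairs A d" by (auto simp: difference_set_def diff_pairs_def)
  then have "card (diff_pairs A d) \<noteq> 0" using finA by auto
  then show ?thesis by (simp add: rep_def)
qed

lemma card_dil_ge1: "l \<in> Q \<Longrightarrow> 1 \<le> real (card (dil l))"
  by (simp add: Q_def Suc_le_eq card_gt_0_iff)

text \<open>Triples in \<open>dil l\<close> have differences \<open>x\<close>, \<open>y\<close> with
  \<open>x\<close>, \<open>l * x\<close>, \<open>y\<close> and \<open>x - y\<close> all in
  \<open>D\<close>, so \<open>dilation_incidences\<close> bounds their shapes with no reference to
  \<open>M\<close>. There are at least \<open>card S * \<kappa> ^ 3\<close> triples, and the energy
  comes from rich lines, again free of \<open>M\<close>.\<close>

lemma dilation_level_bound: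
  assumes S: "S \<subseteq> Q" and \<kappa>: "0 \<le> \<kappa>" "\<And>l. l \<in> S \<Longrightarrow> \<kappa> \<le> real (card (dil l))"
  shows "real (card S) ^ 4 * \<kappa> ^ 18 \<le> (16000 * 256000 ^ 3) * (\<delta> ^ 6 * n ^ 12 * J ^ 3)"
proof (cases "card S = 0")
  case True
  then show ?thesis using J1 n_pos by simp
next
  case False
  define L where "L = real (card S)"
  have L: "L > 0" using False by (simp add: L_def)
  have finS: "finite S" using S finQ finite_subset by blast
  have S0: "0 \<notin> S" using S Q_nz by auto
  define \<Omega> where "\<Omega> = (SIGMA l:S. dil l \<times> dil l \<times> dil l)"
  have "real (card \<Omega>) = (\<Sum>l\<in>S. real (card (dil l)) ^ 3)"
    unfolding \<Omega>_def using finS by (simp add: card_SigmaI card_cartesian_product power3_eq_cube mult_ac)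
  also have "\<dots> \<ge> L * \<kappa> ^ 3"
    unfolding L_def using \<kappa> by (intro sum_bounded_below power_mono) auto
  finally have c\<Omega>: "L * \<kappa> ^ 3 \<le> real (card \<Omega>)" .
  define Z where "Z = real (card (diff_shape ` \<Omega>))"
  have "Z ^ 3 \<le> 8000 * (real (card D) ^ 2 * real (card D) ^ 2 * (real (card S) * \<delta>) ^ 2 + (real (card S) * \<delta>) ^ 3)"
    unfolding Z_def
  proof (rule dilation_incidences[OF finS finD finD S0])
    fix l x y assume "(l, x, y) \<in> diff_shape ` \<Omega>"
    then obtain a b c where z: "l \<in> S" "a \<in> dil l" "b \<in> dil l" "c \<in> dil l" "x = a - b" "y = a - c"
      by (auto simp: \<Omega>_def)
    have "l * x = l * a - l * b" "x - y = c - b" by (auto simp: z algebra_simps)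
    then show "l \<in> S \<and> l * x \<in> D \<and> y \<in> D \<and> x - y \<in> D"
      using z by (auto simp: dilate_part_def intro: diffI)
  qed
  then have "Z ^ 3 \<le> 8000 * (\<delta> ^ 6 * L ^ 2 + (L * \<delta>) ^ 3)"
    unfolding \<delta>_def[symmetric] L_def[symmetric] by (simp add: power_mult_distrib power_numeral_reduce mult_ac)
  moreover have "(L * \<delta>) ^ 3 \<le> \<delta> ^ 6 * L ^ 2"
  proof -
    have "L = (\<Sum>l\<in>S. 1)" by (simp add: L_def)
    also have "\<dots> \<le> (\<Sum>l\<in>S. real (card (dil l)))" using S card_dil_ge1 by (intro sum_mono) auto
    also have "\<dots> \<le> n ^ 2" by (rule sum_card_dil[OF S])
    also have "\<dots> \<le> \<delta> ^ 2" using n_le_\<delta> n_pos by (intro power_mono) auto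
    also have "\<dots> \<le> \<delta> ^ 3" using n_le_\<delta> n2 by (intro power_increasing) auto
    finally have "(L ^ 2 * \<delta> ^ 3) * L \<le> (L ^ 2 * \<delta> ^ 3) * \<delta> ^ 3"
      using L n_le_\<delta> n_pos by (intro mult_left_mono) auto
    then show ?thesis by (simp add: power_mult_distrib power_numeral_reduce mult_ac)
  qed
  ultimately have Z: "Z ^ 3 \<le> 16000 * (\<delta> ^ 6 * L ^ 2)" by (rule absorb_lower_term)
  have "real (card \<Omega>) ^ 2 \<le> Z * (\<Sum>l\<in>S. \<Sum>d\<in>D. rep (dil l) d * real (card {((a, a'), (c, c')).
      (a, a') \<in> diff_pairs (dil l) d \<and> (c, c') \<in> diff_pairs (dil l) d \<and> True}))"
    unfolding Z_def
    by (rule translation_energy[where Pr = "\<lambda>_. True"])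
       (use finS finD in \<open>auto simp: \<Omega>_def intro!: diffI intro: subsetD[OF dil_subset]\<close>)
  also have "\<dots> \<le> Z * (\<Sum>l\<in>S. \<Sum>d\<in>D. rep (dil l) d * (rep (dil l) d * rep (dil l) d))"
    using card_pair_coincidences_le[OF fin_dil fin_dil, of _ _ _ "\<lambda>_. True"]
    by (intro mult_left_mono sum_mono) (auto simp: Z_def)
  also have "(\<Sum>l\<in>S. \<Sum>d\<in>D. rep (dil l) d * (rep (dil l) d * rep (dil l) d)) = (\<Sum>(l, d)\<in>S \<times> D. rep (dil l) d ^ 3)"
    by (simp add: sum.cartesian_product power3_eq_cube mult_ac)
  also have "Z * \<dots> \<le> Z * (256000 * n ^ 4 * J)"
    using rich_lines_cubic_bound[OF S] by (intro mult_left_mono) (auto simp: Z_def)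
  finally have "real (card \<Omega>) ^ 2 \<le> Z * (256000 * n ^ 4 * J)" .
  moreover have "(L * \<kappa> ^ 3) ^ 2 \<le> real (card \<Omega>) ^ 2" using c\<Omega> L \<kappa>(1) by (intro power_mono) auto
  ultimately have "((L * \<kappa> ^ 3) ^ 2) ^ 3 \<le> (Z * (256000 * n ^ 4 * J)) ^ 3"
    by (intro power_mono) auto
  also have "\<dots> = Z ^ 3 * (256000 ^ 3 * n ^ 12 * J ^ 3)"
    by (simp add: power_mult_distrib flip: power_mult)
  also have "\<dots> \<le> 16000 * (\<delta> ^ 6 * L ^ 2) * (256000 ^ 3 * n ^ 12 * J ^ 3)"
    using J1 n_pos by (intro mult_right_mono[OF Z]) auto
  finally have "L ^ 2 * (L ^ 4 * \<kappa> ^ 18) \<le> L ^ 2 * ((16000 * 256000 ^ 3) * (\<delta> ^ 6 * n ^ 12 * J ^ 3))"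
    by (simp add: power_mult_distrib mult_ac flip: power_mult power_add)
  then show ?thesis using L unfolding L_def[symmetric] by (subst (asm) mult_le_cancel_left_pos) auto
qed

text \<open>Cauchy-Schwarz separates the sum of \<open>rep ^ 2 * r\<close> into the sums of
  \<open>rep ^ 3\<close>, handled by rich lines, and of \<open>rep * r ^ 2\<close>, handled by
  \<open>dilate_incidences\<close> on each dyadic level of \<open>r\<close>. The sixth power
  combines this square with the cube in the incidence bound.\<close>

lemma level_mixed_energy:
  assumes S: "S \<subseteq> Q" and \<kappa>: "1 \<le> \<kappa>" "\<And>l. l \<in> S \<Longrightarrow> \<kappa> \<le> real (card (dil l)) \<and> real (card (dil l)) \<le> 2 * \<kappa>"
  shows "(\<Sum>l\<in>S. real (card (dil l)) * (\<Sum>d\<in>D. rep (dil l) d ^ 2 * r d)) ^ 6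
    \<le> (64 * 256000 ^ 3 * (4096000 * 1024000008)) * (J ^ 6 * M ^ 4 * n ^ 20 * (\<kappa> ^ 4 * real (card S)) ^ 2)"
proof -
  define L where "L = real (card S)"
  define L' where "L' = (\<Sum>l\<in>S. real (card (dil l)))"
  have finS: "finite S" using S finQ finite_subset by blast
  have L0: "L \<ge> 0" "L' \<ge> 0" by (auto simp: L_def L'_def intro: sum_nonneg)
  have L'1: "L' \<le> 2 * (\<kappa> * L)"
    unfolding L'_def L_def using sum_bounded_above[of S "\<lambda>l. real (card (dil l))" "2 * \<kappa>"] \<kappa>(2)
    by (simp add: mult_ac)
  have "\<kappa> * L \<le> L'"
    unfolding L'_def L_def using sum_bounded_below[of S \<kappa> "\<lambda>l. real (card (dil l))"] \<kappa>(2)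
    by (simp add: mult_ac)
  then have \<kappa>L: "\<kappa> * L \<le> n ^ 2" using sum_card_dil[OF S] by (simp add: L'_def)
  define U where "U = (\<Sum>(l, d)\<in>S \<times> D. rep (dil l) d * r d ^ 2)"
  define X where "X = (\<Sum>(l, d)\<in>S \<times> D. rep (dil l) d ^ 2 * r d)"
  have X0: "X \<ge> 0" unfolding X_def by (intro sum_nonneg) auto
  have U0: "U \<ge> 0" unfolding U_def by (intro sum_nonneg) auto
  \<comment> \<open>The factorisation \<open>rep ^ 2 * r = rep ^ (3/2) * (rep ^ (1/2) * r)\<close>
    behind the Cauchy-Schwarz step.\<close>
  have "X ^ 2 = (\<Sum>(l, d)\<in>S \<times> D. sqrt (rep (dil l) d ^ 3) * (sqrt (rep (dil l) d) * r d)) ^ 2"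
    unfolding X_def
  proof (intro arg_cong[of _ _ "\<lambda>x. x ^ 2"] sum.cong refl, clarify)
    fix l d
    have "sqrt (rep (dil l) d ^ 3) * sqrt (rep (dil l) d) = sqrt ((rep (dil l) d ^ 2) ^ 2)"
      by (simp add: real_sqrt_mult[symmetric] power_numeral_reduce mult_ac del: real_sqrt_abs)
    also have "\<dots> = rep (dil l) d ^ 2" by (subst real_sqrt_abs) simp
    finally show "rep (dil l) d ^ 2 * r d = sqrt (rep (dil l) d ^ 3) * (sqrt (rep (dil l) d) * r d)"
      by (simp only: mult.assoc[symmetric])
  qed
  also have "\<dots> \<le> (\<Sum>(l, d)\<in>S \<times> D. sqrt (rep (dil l) d ^ 3) ^ 2) * (\<Sum>(l, d)\<in>S \<times> D. (sqrt (rep (dil l) d) * r d) ^ 2)"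
    using Cauchy_Schwarz_ineq_sum[of "\<lambda>(l, d). sqrt (rep (dil l) d ^ 3)" "\<lambda>(l, d). sqrt (rep (dil l) d) * r d" "S \<times> D"]
    by (simp add: case_prod_beta)
  also have "\<dots> = (\<Sum>(l, d)\<in>S \<times> D. rep (dil l) d ^ 3) * U"
    unfolding U_def by (simp add: power_mult_distrib)
  also have "\<dots> \<le> (256000 * n ^ 4 * J) * U"
    using U0 by (intro mult_right_mono rich_lines_cubic_bound[OF S])
  finally have X2: "X ^ 2 \<le> (256000 * n ^ 4 * J) * U" .
  obtain k where k: "n < 2 ^ k" "real k \<le> 2 * J" "2 ^ k \<le> 2 * n" by (rule dyadic_levels)
  define B where "B = 16000 * M ^ 2 * n ^ 3"
  define Dj where "Dj j = {d \<in> D. dyadic_level (r d) = j}" for j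
  define I where "I j = (\<Sum>l\<in>S. \<Sum>d\<in>Dj j. rep (dil l) d)" for j
  have I0: "I j \<ge> 0" for j unfolding I_def by (intro sum_nonneg) auto
  have "U = (\<Sum>d\<in>D. r d ^ 2 * (\<Sum>l\<in>S. rep (dil l) d))"
    unfolding U_def sum.cartesian_product[symmetric]
    by (subst sum.swap) (simp add: sum_distrib_left mult_ac)
  also have "\<dots> = (\<Sum>j<k. \<Sum>d\<in>Dj j. r d ^ 2 * (\<Sum>l\<in>S. rep (dil l) d))"
    unfolding Dj_def
    by (rule sum.group[symmetric])
       (use finD r_ge1 dyadic_level(3) le_less_trans[OF r_le_n k(1)] in auto)
  also have "\<dots> \<le> (\<Sum>j<k. 4 * 4 ^ j * I j)"
  proof (rule sum_mono)
    fix j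
    have "(\<Sum>d\<in>Dj j. r d ^ 2 * (\<Sum>l\<in>S. rep (dil l) d)) \<le> (\<Sum>d\<in>Dj j. (2 ^ (j + 1)) ^ 2 * (\<Sum>l\<in>S. rep (dil l) d))"
      using dyadic_level(2)[OF r_ge1]
      by (intro sum_mono mult_right_mono power_mono sum_nonneg) (auto simp: Dj_def)
    also have "\<dots> = 4 * 4 ^ j * (\<Sum>d\<in>Dj j. \<Sum>l\<in>S. rep (dil l) d)"
      by (simp add: sum_distrib_left power_mult[symmetric] power_mult_distrib power2_eq_square flip: power_mult_distrib)
    also have "(\<Sum>d\<in>Dj j. \<Sum>l\<in>S. rep (dil l) d) = I j" unfolding I_def by (rule sum.swap)
    finally show "(\<Sum>d\<in>Dj j. r d ^ 2 * (\<Sum>l\<in>S. rep (dil l) d)) \<le> 4 * 4 ^ j * I j" .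
  qed
  finally have U1: "U \<le> (\<Sum>j<k. 4 * 4 ^ j * I j)" .
  \<comment> \<open>On this level \<open>r\<close> is about \<open>t = 2 ^ j\<close>. The factor
    \<open>t ^ 6\<close> turns \<open>card (Dj j) ^ 2\<close> into the square of
    \<open>card (Dj j) * t ^ 3\<close>, which is at most \<open>B ^ 2\<close> on every
    level.\<close>
  have "(4 * 4 ^ j * I j) ^ 3 \<le> 512000 * (n ^ 2 * B ^ 2 * L' ^ 2 + n ^ 6 * L' ^ 3)" if j: "j < k" for j
  proof -
    define t where "t = (2::real) ^ j"
    have t0: "t > 0" by (simp add: t_def)
    have "2 * t \<le> 2 ^ k" unfolding t_def using j
      by (metis Suc_leI one_le_numeral power_Suc power_increasing)
    then have tn: "t \<le> n" using k(3) by linarith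
    have four: "(4::real) ^ j = t ^ 2" 
    proof -
      have "(4::real) ^ j = (2 ^ 2) ^ j" by simp
      also have "\<dots> = t ^ 2" unfolding t_def by (simp only: power_mult[symmetric] mult.commute)
      finally show ?thesis .
    qed
    have "real (card (Dj j)) * t ^ 3 \<le> real (card {d \<in> D. t \<le> r d}) * t ^ 3"
      using dyadic_level(1)[OF r_ge1] finD t0
      by (intro mult_right_mono of_nat_mono card_mono) (auto simp: Dj_def t_def)
    also have "\<dots> \<le> B" unfolding B_def by (rule card_popular_differences[OF t0])
    finally have DB: "real (card (Dj j)) * t ^ 3 \<le> B" .
    have "(4 * 4 ^ j * I j) ^ 3 = 64 * t ^ 6 * I j ^ 3"
      unfolding four by (simp add: power_mult_distrib flip: power_mult)
    also have "\<dots> \<le> 64 * t ^ 6 * (8000 * (n ^ 2 * real (card (Dj j)) ^ 2 * L' ^ 2 + L' ^ 3))"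
      unfolding I_def L'_def using t0 by (intro mult_left_mono dilate_incidences[OF S]) (auto simp: Dj_def)
    also have "\<dots> = 512000 * (n ^ 2 * (real (card (Dj j)) * t ^ 3) ^ 2 * L' ^ 2 + t ^ 6 * L' ^ 3)"
      by (simp add: power_mult_distrib algebra_simps flip: power_mult)
    also have "\<dots> \<le> 512000 * (n ^ 2 * B ^ 2 * L' ^ 2 + n ^ 6 * L' ^ 3)"
      using DB tn t0 L0 by (intro mult_left_mono add_mono mult_right_mono power_mono) auto
    finally show ?thesis .
  qed
  then have "(\<Sum>j<k. 4 * 4 ^ j * I j) ^ 3 \<le> real k ^ 3 * (512000 * (n ^ 2 * B ^ 2 * L' ^ 2 + n ^ 6 * L' ^ 3))"
    using I0 by (intro sum_cube_le) auto
  also have "\<dots> \<le> (2 * J) ^ 3 * (512000 * (n ^ 2 * B ^ 2 * L' ^ 2 + n ^ 6 * L' ^ 3))"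
    using k(2) L0 n_pos by (intro mult_right_mono power_mono) auto
  finally have "U ^ 3 \<le> (2 * J) ^ 3 * (512000 * (n ^ 2 * B ^ 2 * L' ^ 2 + n ^ 6 * L' ^ 3))"
    using power_mono[OF U1 U0, of 3] by linarith
  \<comment> \<open>The first term gives \<open>4 * 16000 ^ 2\<close>; the second gives 8 after one
    factor \<open>\<kappa> * L\<close> is replaced by \<open>n ^ 2\<close>.\<close>
  also have "n ^ 2 * B ^ 2 * L' ^ 2 + n ^ 6 * L' ^ 3 \<le> 1024000008 * (M ^ 4 * n ^ 8 * (\<kappa> * L) ^ 2)"
  proof -
    have "n ^ 2 * B ^ 2 * L' ^ 2 \<le> n ^ 2 * B ^ 2 * (2 * (\<kappa> * L)) ^ 2"
      using L'1 L0 by (intro mult_left_mono power_mono) auto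
    also have "\<dots> = 1024000000 * (M ^ 4 * n ^ 8 * (\<kappa> * L) ^ 2)"
      unfolding B_def by (simp add: power_mult_distrib flip: power_mult power_add)
    finally have 1: "n ^ 2 * B ^ 2 * L' ^ 2 \<le> 1024000000 * (M ^ 4 * n ^ 8 * (\<kappa> * L) ^ 2)" .
    have "n ^ 6 * L' ^ 3 \<le> n ^ 6 * (2 * (\<kappa> * L)) ^ 3"
      using L'1 L0 n_pos by (intro mult_left_mono power_mono) auto
    also have "\<dots> = 8 * (n ^ 6 * (\<kappa> * L) ^ 2 * (\<kappa> * L))" by (simp add: power_mult_distrib power_numeral_reduce)
    also have "\<dots> \<le> 8 * (n ^ 6 * (\<kappa> * L) ^ 2 * n ^ 2)"
      using \<kappa>L n_pos by (intro mult_left_mono) auto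
    also have "\<dots> = 8 * (1 * (n ^ 8 * (\<kappa> * L) ^ 2))" by (simp add: power_numeral_reduce)
    also have "\<dots> \<le> 8 * (M ^ 4 * (n ^ 8 * (\<kappa> * L) ^ 2))"
      using one_le_power[OF M1, of 4] n_pos by (intro mult_left_mono mult_right_mono) auto
    finally show ?thesis using 1 by (simp add: mult_ac)
  qed
  finally have U3: "U ^ 3 \<le> (4096000 * 1024000008) * (J ^ 3 * M ^ 4 * n ^ 8 * (\<kappa> * L) ^ 2)"
    using J1 by (simp add: power_mult_distrib mult_left_mono mult_ac)
  have "(\<Sum>l\<in>S. real (card (dil l)) * (\<Sum>d\<in>D. rep (dil l) d ^ 2 * r d)) \<le> (\<Sum>l\<in>S. 2 * \<kappa> * (\<Sum>d\<in>D. rep (dil l) d ^ 2 * r d))"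
    using \<kappa>(2) by (intro sum_mono mult_right_mono sum_nonneg) auto
  also have "\<dots> = 2 * \<kappa> * X" unfolding X_def sum.cartesian_product[symmetric] by (simp add: sum_distrib_left)
  finally have "(\<Sum>l\<in>S. real (card (dil l)) * (\<Sum>d\<in>D. rep (dil l) d ^ 2 * r d)) ^ 6 \<le> (2 * \<kappa> * X) ^ 6"
    by (intro power_mono sum_nonneg mult_nonneg_nonneg) auto
  also have "\<dots> = 64 * \<kappa> ^ 6 * (X ^ 2) ^ 3" by (simp add: power_mult_distrib flip: power_mult)
  also have "\<dots> \<le> 64 * \<kappa> ^ 6 * ((256000 * n ^ 4 * J) * U) ^ 3"
    using X2 \<kappa>(1) by (intro mult_left_mono power_mono) auto
  also have "\<dots> = 64 * \<kappa> ^ 6 * (256000 ^ 3 * n ^ 12 * J ^ 3) * U ^ 3"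
    by (simp add: power_mult_distrib flip: power_mult)
  also have "\<dots> \<le> 64 * \<kappa> ^ 6 * (256000 ^ 3 * n ^ 12 * J ^ 3) * ((4096000 * 1024000008) * (J ^ 3 * M ^ 4 * n ^ 8 * (\<kappa> * L) ^ 2))"
    using U3 \<kappa>(1) J1 n_pos by (intro mult_left_mono) auto
  also have "\<dots> = (64 * 256000 ^ 3 * (4096000 * 1024000008)) * (J ^ 6 * M ^ 4 * n ^ 20 * (\<kappa> ^ 4 * L) ^ 2)"
    by (simp add: power_mult_distrib mult_ac flip: power_mult power_add)
  finally show ?thesis by (simp add: L_def)
qed

text \<open>The number of dilates on the level is eliminated through
  \<open>y = \<kappa> ^ 4 * L\<close>: \<open>dilation_level_bound\<close> yields
  \<open>y ^ 14 * M ^ 30\<close>, whereas the seventh power of the previous estimate needs only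
  \<open>M ^ 28 * y ^ 14\<close>. The surplus is the saving \<open>M ^ 2\<close>.\<close>

lemma level_mixed_energy':
  assumes S: "S \<subseteq> Q" and \<kappa>: "1 \<le> \<kappa>" "\<And>l. l \<in> S \<Longrightarrow> \<kappa> \<le> real (card (dil l)) \<and> real (card (dil l)) \<le> 2 * \<kappa>"
    and small: "\<delta> ^ 6 * M ^ 10 \<le> n ^ 10"
  shows "(\<Sum>l\<in>S. real (card (dil l)) * (\<Sum>d\<in>D. rep (dil l) d ^ 2 * r d)) ^ 42 * M ^ 2
    \<le> CW ^ 7 * CB ^ 3 * J ^ 51 * n ^ 210"
proof -
  define L where "L = real (card S)"
  define y where "y = \<kappa> ^ 4 * L"
  define w where "w = (\<Sum>l\<in>S. real (card (dil l)) * (\<Sum>d\<in>D. rep (dil l) d ^ 2 * r d))"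
  have L0: "L \<ge> 0" by (simp add: L_def)
  have w0: "w \<ge> 0" unfolding w_def by (intro sum_nonneg mult_nonneg_nonneg) auto
  have "\<kappa> * L \<le> (\<Sum>l\<in>S. real (card (dil l)))"
    unfolding L_def using sum_bounded_below[of S \<kappa> "\<lambda>l. real (card (dil l))"] \<kappa>(2)
    by (simp add: mult_ac)
  then have \<kappa>L: "\<kappa> * L \<le> n ^ 2" using sum_card_dil[OF S] by linarith
  have "L ^ 4 * \<kappa> ^ 18 \<le> CB * (\<delta> ^ 6 * n ^ 12 * J ^ 3)"
    unfolding L_def CB_def using \<kappa> by (intro dilation_level_bound[OF S]) auto
  then have "(L ^ 4 * \<kappa> ^ 18) * M ^ 10 \<le> CB * (\<delta> ^ 6 * n ^ 12 * J ^ 3) * M ^ 10"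
    using M1 by (intro mult_right_mono) auto
  also have "\<dots> = CB * n ^ 12 * J ^ 3 * (\<delta> ^ 6 * M ^ 10)" by (simp add: mult_ac)
  also have "\<dots> \<le> CB * n ^ 12 * J ^ 3 * n ^ 10"
    using small CB_CW_pos n_pos J1 by (intro mult_left_mono) auto
  also have "\<dots> = CB * n ^ 22 * J ^ 3" by (simp add: power_numeral_reduce)
  \<comment> \<open>These exponents combine to
    \<open>L ^ 14 * \<kappa> ^ 56 = y ^ 14\<close>.\<close>
  finally have "((L ^ 4 * \<kappa> ^ 18) * M ^ 10) ^ 3 * (\<kappa> * L) ^ 2 \<le> (CB * n ^ 22 * J ^ 3) ^ 3 * (n ^ 2) ^ 2"
    using \<kappa> L0 M1 \<kappa>L CB_CW_pos n_pos J1
    by (intro mult_mono[OF power_mono power_mono[OF \<kappa>L]]) auto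
  note raised = this
  have y: "y ^ 14 * M ^ 30 \<le> CB ^ 3 * n ^ 70 * J ^ 9"
  proof -
    have "(CB * n ^ 22 * J ^ 3) ^ 3 * (n ^ 2) ^ 2 = CB ^ 3 * ((n ^ 22) ^ 3 * (n ^ 2) ^ 2) * (J ^ 3) ^ 3"
      by (simp only: power_mult_distrib mult_ac)
    also have "\<dots> = CB ^ 3 * n ^ 70 * J ^ 9" by (simp flip: power_mult)
    finally have "((L ^ 4 * \<kappa> ^ 18) * M ^ 10) ^ 3 * (\<kappa> * L) ^ 2 \<le> CB ^ 3 * n ^ 70 * J ^ 9"
      using raised by simp
    moreover have "((L ^ 4 * \<kappa> ^ 18) * M ^ 10) ^ 3 * (\<kappa> * L) ^ 2 = y ^ 14 * M ^ 30"
      unfolding y_def by (simp add: power_mult_distrib mult_ac flip: power_mult)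
    ultimately show ?thesis by simp
  qed
  have "w ^ 6 \<le> CW * (J ^ 6 * M ^ 4 * n ^ 20 * y ^ 2)"
    unfolding w_def CW_def y_def L_def by (rule level_mixed_energy[OF S \<kappa>])
  then have "(w ^ 6) ^ 7 * M ^ 2 \<le> (CW * (J ^ 6 * M ^ 4 * n ^ 20 * y ^ 2)) ^ 7 * M ^ 2"
    using w0 by (intro mult_right_mono power_mono) auto
  also have "\<dots> = CW ^ 7 * J ^ 42 * n ^ 140 * (y ^ 14 * M ^ 30)"
    by (simp add: power_mult_distrib mult_ac flip: power_mult power_add)
  also have "\<dots> \<le> CW ^ 7 * J ^ 42 * n ^ 140 * (CB ^ 3 * n ^ 70 * J ^ 9)"
    using y CB_CW_pos J1 n_pos by (intro mult_left_mono) auto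
  also have "\<dots> = CW ^ 7 * CB ^ 3 * J ^ 51 * n ^ 210" by (simp add: mult_ac flip: power_add)
  finally show ?thesis by (simp add: w_def flip: power_mult)
qed

text \<open>With at most \<open>2 * J\<close> levels, each may contribute
  \<open>n ^ 5 / (2 * J ^ 2)\<close>. The 42nd power of this costs \<open>2 ^ 42 * J ^ 84\<close>,
  which with the \<open>J ^ 51\<close> of the level estimate gives the exponent 135; the saving
  \<open>M ^ 2\<close> pays for it.\<close>

lemma mixed_energy_bound:
  assumes small: "\<delta> ^ 6 * M ^ 10 \<le> n ^ 10" and large: "M ^ 2 \<ge> 2 ^ 42 * CW ^ 7 * CB ^ 3 * J ^ 135"
  shows "W \<le> n ^ 5 / J"
proof -
  obtain k where k: "n < 2 ^ k" "real k \<le> 2 * J" by (rule dyadic_levels)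
  define h where "h l = real (card (dil l)) * (\<Sum>d\<in>D. rep (dil l) d ^ 2 * r d)" for l
  have h0: "h l \<ge> 0" for l unfolding h_def by (intro mult_nonneg_nonneg sum_nonneg) auto
  define S where "S j = {l \<in> Q. dyadic_level (real (card (dil l))) = j}" for j
  have "W = (\<Sum>j<k. sum h (S j))"
    unfolding W_def h_def[symmetric] S_def
    by (rule sum.group[symmetric])
       (use finQ card_dil_ge1 dyadic_level(3) le_less_trans[OF card_dil_le k(1)] in auto)
  also have "\<dots> \<le> (\<Sum>j<k. n ^ 5 / (2 * J ^ 2))"
  proof (rule sum_mono)
    fix j
    have "(sum h (S j)) ^ 42 * M ^ 2 \<le> CW ^ 7 * CB ^ 3 * J ^ 51 * n ^ 210"
      unfolding h_def
    proof (rule level_mixed_energy'[where \<kappa> = "2 ^ j"])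
      show "2 ^ j \<le> real (card (dil l)) \<and> real (card (dil l)) \<le> 2 * 2 ^ j" if "l \<in> S j" for l
        using that dyadic_level(1,2)[OF card_dil_ge1, of l] by (auto simp: S_def)
    qed (use small in \<open>auto simp: S_def\<close>)
    also have "\<dots> = (n ^ 5 / (2 * J ^ 2)) ^ 42 * (2 ^ 42 * CW ^ 7 * CB ^ 3 * J ^ 135)"
    proof -
      have e1: "J ^ 135 / J ^ 84 = J ^ 51" using J1 power_diff[of J 84 135] by simp
      have e2: "(n ^ 5 / (2 * J ^ 2)) ^ 42 * (2 ^ 42 * CW ^ 7 * CB ^ 3 * J ^ 135)
          = n ^ 210 * CW ^ 7 * CB ^ 3 * (J ^ 135 / J ^ 84)"
        by (simp add: power_divide power_mult_distrib flip: power_mult)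
      show ?thesis unfolding e2 e1 by (simp only: mult_ac)
    qed
    also have "\<dots> \<le> (n ^ 5 / (2 * J ^ 2)) ^ 42 * M ^ 2"
      using large by (intro mult_left_mono) auto
    finally have "(sum h (S j)) ^ 42 \<le> (n ^ 5 / (2 * J ^ 2)) ^ 42"
      using M1 by (subst (asm) mult_le_cancel_right_pos) auto
    moreover have "0 \<le> sum h (S j)" "0 \<le> n ^ 5 / (2 * J ^ 2)"
      using h0 n_pos by (auto intro: sum_nonneg)
    ultimately show "sum h (S j) \<le> n ^ 5 / (2 * J ^ 2)" by (simp only: power_mono_iff zero_less_numeral)
  qed
  also have "\<dots> = real k * (n ^ 5 / (2 * J ^ 2))" by simp
  also have "\<dots> \<le> 2 * J * (n ^ 5 / (2 * J ^ 2))"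
    using k(2) n_pos J1 by (intro mult_right_mono) auto
  also have "\<dots> = n ^ 5 / J" using J1 by (simp add: power2_eq_square)
  finally show ?thesis .
qed

end

section \<open>Small doubling\<close>

text \<open>Large and small doubling are separated by comparing \<open>M ^ 2\<close> with
  \<open>C0 * J ^ 135\<close>.\<close>

definition C0 :: real where "C0 = 2 ^ 42 * CW ^ 7 * CB ^ 3"

text \<open>Bounds the number of dyadic ranges by \<open>K1 * root 3 J\<close>: 2 for rounding, the
  logarithm of the constant factor, and \<open>276 * 5\<close> from \<open>log_le_root3\<close>
  applied to \<open>J ^ 276\<close>.\<close>

definition K1 :: real where "K1 = 2 + log 2 (16000 * C0 ^ 2) + 276 * 5"

definition Chi :: real where "Chi = 64 * 256000 ^ 3 * (16000 * 16)"

definition Clo :: real where "Clo = 16 * 4096 * 130000 ^ 3 * 16000 * K1 ^ 3"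

lemma C0_ge1: "C0 \<ge> 1"
  by (simp add: C0_def CW_def CB_def)

lemma log_C0_nonneg: "log 2 (16000 * C0 ^ 2) \<ge> 0"
proof -
  have "16000 * C0 ^ 2 \<ge> 1" using one_le_power[OF C0_ge1, of 2] by linarith
  then show ?thesis by (subst zero_le_log_cancel_iff) linarith+
qed

lemma K1_pos: "K1 > 0"
  using log_C0_nonneg by (simp add: K1_def)

text \<open>Applied to \<open>J\<close>: the number of dyadic ranges is logarithmic in
  \<open>J\<close>, and since the energy is later cubed, a cube root of \<open>J\<close> is exactly
  affordable.\<close>

lemma log_le_root3:
  assumes "x \<ge> (1::real)"
  shows "log 2 x \<le> 5 * root 3 x"
proof -
  define y where "y = root 3 x"
  have y: "y \<ge> 1" "x = y ^ 3" using assms by (auto simp: y_def)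
  have "ln y \<le> y" using ln_le_minus_one[of y] y by simp
  have l2: "ln (2::real) \<ge> 3 / 5"
  proof -
    have "ln (2::real) \<ge> 2 / 3" by (rule ln2_ge_two_thirds)
    then show ?thesis by linarith
  qed
  have "log 2 x = 3 * ln y / ln 2" using y by (simp add: log_def ln_realpow)
  also have "\<dots> \<le> 3 * y / (3 / 5)"
    using \<open>ln y \<le> y\<close> y l2 by (intro frac_le) auto
  finally show ?thesis by (simp add: y_def)
qed

section \<open>Small doubling: the cases of popular and unpopular differences
  \<open>a - c\<close>\<close>

context nonzero_set
begin

lemma M_le_n: "M \<le> n"
proof -
  have "card AA \<le> card (A \<times> A)"
    by (rule surj_card_le[of _ _ "\<lambda>(a, b). a * b"]) (use finA in \<open>auto simp: product_set_def\<close>)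
  then have "P \<le> n * n" by (simp add: P_def n_def card_cartesian_product flip: of_nat_mult)
  then show ?thesis using n_pos by (simp add: M_def divide_le_eq)
qed

lemma J_le_n: "J \<le> n"
proof -
  have "n < 2 powr n" 
    using n_pos by (metis less_exp n_def of_nat_less_two_power powr_realpow zero_less_numeral)
  then show ?thesis using n_pos by (simp add: J_def log_le_iff)
qed

text \<open>At most \<open>n ^ 2 / V\<close> differences have \<open>V\<close> or more
  representations, so \<open>shape_bound\<close> with this small set beats the version with
  \<open>D\<close>. Even with the full logarithmic loss in \<open>shape_energy\<close>, the choice
  of \<open>V\<close> leaves no logarithm in the result.\<close>

lemma popular_differences_case:
  assumes V: "V > 0" "V ^ 3 = n * M ^ 5 * J ^ 6"
    and \<Omega>: "\<And>e a b c. (e, a, b, c) \<in> \<Omega> \<Longrightarrow>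
      e \<in> A \<and> a \<in> A \<and> b \<in> A \<and> c \<in> A \<and> e * (a - b) \<in> popular_dilates k0 \<and> V \<le> r (a - c)"
    and c\<Omega>: "n ^ 4 / 2 \<le> real (card \<Omega>)"
  shows "n ^ 10 \<le> Chi ^ 2 * (\<delta> ^ 6 * M ^ 10)"
proof -
  define S where "S = {s \<in> D. V \<le> r s}"
  define s where "s = real (card S)"
  define Z where "Z = real (card (diff_shape ` \<Omega>))"
  have finS: "finite S" using finD by (simp add: S_def)
  have Chi1: "Chi \<ge> 1" by (simp add: Chi_def)
  have pos: "\<delta> > 0" "M > 0" "n > 0" "J > 0" "s \<ge> 0" "Z \<ge> 0"
    using n_le_\<delta> n_pos M1 J1 by (auto simp: s_def Z_def)
  have "s * V \<le> (\<Sum>d\<in>S. r d)" unfolding s_def by (rule sum_bounded_below) (simp add: S_def)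
  also have "\<dots> \<le> n ^ 2" unfolding n_def by (rule sum_rep[OF finA finS])
  finally have sV: "s * V \<le> n ^ 2" .
  have "Z ^ 3 \<le> 8000 * ((n * \<delta> / k0) ^ 2 * real (card S) ^ 2 * (n * \<delta>) ^ 2 + (n * \<delta>) ^ 3)"
    unfolding Z_def by (rule shape_bound[OF k0_pos finS]) (use \<Omega> in \<open>auto simp: S_def intro: diffI\<close>)
  also have "(n * \<delta> / k0) ^ 2 * real (card S) ^ 2 * (n * \<delta>) ^ 2 = 16 * (M ^ 4 * \<delta> ^ 4 * s ^ 2 * n ^ 2)"
    unfolding k0_def s_def[symmetric] using pos
    by (simp add: power_mult_distrib flip: power_mult)
  finally have Z: "Z ^ 3 \<le> 8000 * (16 * (M ^ 4 * \<delta> ^ 4 * s ^ 2 * n ^ 2) + (n * \<delta>) ^ 3)" .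
  have "real (card \<Omega>) ^ 2 \<le> Z * (256000 * M ^ 2 * n ^ 4 * J)"
    unfolding Z_def using \<Omega> by (intro shape_energy) blast
  moreover have "(n ^ 4 / 2) ^ 2 \<le> real (card \<Omega>) ^ 2" using c\<Omega> n_pos by (intro power_mono) auto
  ultimately have "(n ^ 4 / 2) ^ 2 \<le> Z * (256000 * M ^ 2 * n ^ 4 * J)" by (rule order_trans[rotated])
  then have "((n ^ 4 / 2) ^ 2) ^ 3 \<le> (Z * (256000 * M ^ 2 * n ^ 4 * J)) ^ 3"
    using n_pos by (intro power_mono) auto
  then have "n ^ 12 * n ^ 12 \<le> n ^ 12 * (64 * 256000 ^ 3 * M ^ 6 * J ^ 3 * Z ^ 3)"
    by (simp add: power_divide power_mult_distrib mult_ac flip: power_mult)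
  then have N: "n ^ 12 \<le> 64 * 256000 ^ 3 * M ^ 6 * J ^ 3 * Z ^ 3"
    using n_pos by (subst (asm) mult_le_cancel_left_pos) auto
  show ?thesis
  proof (cases "(n * \<delta>) ^ 3 \<le> 16 * (M ^ 4 * \<delta> ^ 4 * s ^ 2 * n ^ 2)")
    case True
    have "n ^ 12 \<le> 64 * 256000 ^ 3 * M ^ 6 * J ^ 3 * (16000 * (16 * (M ^ 4 * \<delta> ^ 4 * s ^ 2 * n ^ 2)))"
      using N absorb_lower_term[OF Z True] pos by (meson mult_left_mono order_trans zero_le_numeral mult_nonneg_nonneg zero_le_power less_imp_le)
    also have "\<dots> = n ^ 2 * (Chi * (M ^ 10 * J ^ 3 * \<delta> ^ 4) * s ^ 2)"
      by (simp add: Chi_def power_numeral_reduce)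
    finally have "n ^ 2 * n ^ 10 \<le> n ^ 2 * (Chi * (M ^ 10 * J ^ 3 * \<delta> ^ 4) * s ^ 2)"
      by (simp flip: power_add)
    then have "n ^ 10 \<le> Chi * (M ^ 10 * J ^ 3 * \<delta> ^ 4) * s ^ 2"
      using n_pos by (subst (asm) mult_le_cancel_left_pos) auto
    then have "n ^ 10 * V ^ 2 \<le> Chi * (M ^ 10 * J ^ 3 * \<delta> ^ 4) * s ^ 2 * V ^ 2"
      by (intro mult_right_mono) auto
    also have "\<dots> = Chi * (M ^ 10 * J ^ 3 * \<delta> ^ 4) * (s * V) ^ 2" by (simp add: power_mult_distrib)
    also have "\<dots> \<le> Chi * (M ^ 10 * J ^ 3 * \<delta> ^ 4) * (n ^ 2) ^ 2"
      using sV pos V(1) Chi1 by (intro mult_left_mono power_mono) auto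
    finally have "n ^ 4 * (n ^ 6 * V ^ 2) \<le> n ^ 4 * (Chi * (M ^ 10 * J ^ 3 * \<delta> ^ 4))"
      by (simp add: mult_ac flip: power_mult power_add)
    then have "n ^ 6 * V ^ 2 \<le> Chi * (M ^ 10 * J ^ 3 * \<delta> ^ 4)"
      using n_pos by (subst (asm) mult_le_cancel_left_pos) auto
    then have "(n ^ 6 * V ^ 2) ^ 3 \<le> (Chi * (M ^ 10 * J ^ 3 * \<delta> ^ 4)) ^ 3"
      using pos V(1) by (intro power_mono) auto
    also have "\<dots> = (M ^ 10 * J ^ 9) * (Chi ^ 3 * (\<delta> ^ 6 * M ^ 10) ^ 2)"
      by (simp add: power_mult_distrib mult_ac flip: power_mult)
    also have "(n ^ 6 * V ^ 2) ^ 3 = (n ^ 6) ^ 3 * (V ^ 3) ^ 2"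
      by (simp add: power_mult_distrib flip: power_mult)
    \<comment> \<open>Here the exponents in \<open>V ^ 3\<close> matter: \<open>M ^ 10\<close> and
      \<open>J ^ 9\<close> cancel against the other side, with \<open>J ^ 3\<close> to
      spare.\<close>
    also have "\<dots> = (M ^ 10 * J ^ 9) * (n ^ 20 * J ^ 3)"
      unfolding V(2) by (simp add: power_mult_distrib mult_ac flip: power_mult)
    finally have "n ^ 20 * J ^ 3 \<le> Chi ^ 3 * (\<delta> ^ 6 * M ^ 10) ^ 2"
      using pos by (subst (asm) mult_le_cancel_left_pos) auto
    moreover have "n ^ 20 * 1 \<le> n ^ 20 * J ^ 3"
      using J1 n_pos by (intro mult_left_mono one_le_power) auto
    moreover have "Chi ^ 3 * (\<delta> ^ 6 * M ^ 10) ^ 2 \<le> Chi ^ 4 * (\<delta> ^ 6 * M ^ 10) ^ 2"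
      using Chi1 by (intro mult_right_mono power_increasing) auto
    ultimately have "n ^ 20 \<le> Chi ^ 4 * (\<delta> ^ 6 * M ^ 10) ^ 2" by linarith
    then have "(n ^ 10) ^ 2 \<le> (Chi ^ 2 * (\<delta> ^ 6 * M ^ 10)) ^ 2"
      by (simp add: power_mult_distrib flip: power_mult)
    then show ?thesis by (rule power2_le_imp_le) (use pos Chi1 in auto)
  next
    case False
    then have "Z ^ 3 \<le> 16000 * (n * \<delta>) ^ 3"
      using Z absorb_lower_term[of "Z ^ 3" "(n * \<delta>) ^ 3" "16 * (M ^ 4 * \<delta> ^ 4 * s ^ 2 * n ^ 2)"]
      by (simp add: add.commute)
    then have "n ^ 12 \<le> 64 * 256000 ^ 3 * M ^ 6 * J ^ 3 * (16000 * (n * \<delta>) ^ 3)"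
      using N pos by (meson mult_left_mono order_trans zero_le_numeral mult_nonneg_nonneg zero_le_power less_imp_le)
    then have "n ^ 3 * n ^ 9 \<le> n ^ 3 * (64 * 256000 ^ 3 * 16000 * M ^ 6 * J ^ 3 * \<delta> ^ 3)"
      by (simp add: power_mult_distrib mult_ac flip: power_add)
    then have "n ^ 9 \<le> 64 * 256000 ^ 3 * 16000 * M ^ 6 * J ^ 3 * \<delta> ^ 3"
      using n_pos by (subst (asm) mult_le_cancel_left_pos) auto
    also have "\<dots> = (64 * 256000 ^ 3 * 16000) * (M ^ 6 * J ^ 3 * \<delta> ^ 3)" by simp
    also have "\<dots> \<le> Chi * (M ^ 6 * J ^ 3 * \<delta> ^ 3)"
      using pos by (intro mult_right_mono) (auto simp: Chi_def)
    finally have "(n ^ 9) ^ 2 \<le> (Chi * (M ^ 6 * J ^ 3 * \<delta> ^ 3)) ^ 2" using n_pos by (intro power_mono) auto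
    also have "\<dots> = Chi ^ 2 * (\<delta> ^ 6 * M ^ 10) * (M ^ 2 * J ^ 6)"
      by (simp add: power_mult_distrib mult_ac flip: power_mult power_add)
    \<comment> \<open>The linear term dominates here, with so much room that the crude bounds
      \<open>M <= n\<close> and \<open>J <= n\<close> suffice.\<close>
    also have "\<dots> \<le> Chi ^ 2 * (\<delta> ^ 6 * M ^ 10) * (n ^ 2 * n ^ 6)"
      using pos M_le_n J_le_n by (intro mult_left_mono mult_mono power_mono) auto
    finally have "n ^ 8 * n ^ 10 \<le> n ^ 8 * (Chi ^ 2 * (\<delta> ^ 6 * M ^ 10))"
      by (simp add: mult_ac flip: power_mult power_add)
    then show ?thesis using n_pos by (subst (asm) mult_le_cancel_left_pos) auto
  qed
qed

text \<open>Translations \<open>d\<close> with few representations are controlled through the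
  restriction on \<open>a - c\<close>, without a logarithm. The remaining nonzero \<open>d\<close>
  lie in few dyadic ranges because \<open>rep_bound_nonzero\<close> is nearly sharp when
  \<open>M\<close> is at most a power of \<open>J\<close>.\<close>

lemma restricted_energy_bound:
  assumes V: "V > 0" "V ^ 3 = n * M ^ 5 * J ^ 6" and small: "M ^ 2 \<le> C0 * J ^ 135"
  shows "(\<Sum>d\<in>D. r d * real (card {((a, a'), (c, c')). (a, a') \<in> diff_pairs A d \<and>
      (c, c') \<in> diff_pairs A d \<and> r (a - c) \<le> V})) \<le> 130000 * M ^ 2 * n ^ 3 * (K1 * root 3 J)"
proof -
  define G where "G d = {((a, a'), (c, c')). (a, a') \<in> diff_pairs A d \<and> (c, c') \<in> diff_pairs A d \<and> r (a - c) \<le> V}" for d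
  have finG: "finite (G d)" for d
    by (rule finite_subset[of _ "diff_pairs A d \<times> diff_pairs A d"]) (use finA in \<open>auto simp: G_def\<close>)
  have Gr: "real (card (G d)) \<le> r d * r d" for d
    unfolding G_def by (rule card_pair_coincidences_le[OF finA finA])
  \<comment> \<open>Chosen so that \<open>\<tau> * V * n ^ 2\<close>, the cost of translations below
    \<open>\<tau>\<close>, equals \<open>M ^ 2 * n ^ 3\<close>.\<close>
  define \<tau> where "\<tau> = M ^ 2 * n / V"
  have \<tau>: "\<tau> > 0" using M1 n_pos V by (simp add: \<tau>_def)
  have \<tau>3: "\<tau> ^ 3 * J ^ 6 = M * n ^ 2"
  proof -
    have "\<tau> ^ 3 = M ^ 6 * n ^ 3 / V ^ 3" by (simp add: \<tau>_def power_divide power_mult_distrib flip: power_mult)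
    then show ?thesis unfolding V(2) using M1 n_pos J1 by (simp add: power_numeral_reduce)
  qed
  \<comment> \<open>An upper bound for \<open>(r d / \<tau>) ^ 3\<close> with \<open>d\<close>
    nonzero: \<open>16000 * M ^ 3 * J ^ 6\<close>, with \<open>M ^ 3\<close> replaced by
    \<open>C0 ^ 2 * J ^ 270\<close>.\<close>
  define x where "x = 16000 * C0 ^ 2 * J ^ 276"
  define k where "k = nat \<lceil>log 2 x\<rceil> + 1"
  have x1: "x \<ge> 1"
    unfolding x_def using one_le_power[OF C0_ge1, of 2] one_le_power[OF J1, of 276]
    by (metis mult_mono' mult_1 one_le_numeral zero_le_one)
  then have lx: "log 2 x \<ge> 0" by simp
  have kx: "log 2 x < real k" "real k \<le> log 2 x + 2" using lx unfolding k_def by linarith+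
  have "x = 2 powr (log 2 x)" using x1 by simp
  also have "\<dots> < 2 powr (real k)" using kx(1) by simp
  finally have xk: "x < 2 ^ k" by (simp add: powr_realpow)
  have k_bound: "real k \<le> K1 * root 3 J"
  proof -
    have "log 2 x = log 2 (16000 * C0 ^ 2) + 276 * log 2 J"
      unfolding x_def using C0_ge1 J1 by (simp add: log_mult log_nat_power)
    also have "\<dots> \<le> log 2 (16000 * C0 ^ 2) + 276 * (5 * root 3 J)"
      using log_le_root3[OF J1] by simp
    finally have "real k \<le> (2 + log 2 (16000 * C0 ^ 2)) + 276 * 5 * root 3 J" using kx(2) by linarith
    also have "2 + log 2 (16000 * C0 ^ 2) \<le> (2 + log 2 (16000 * C0 ^ 2)) * root 3 J"
      using log_C0_nonneg J1 by (simp add: mult_le_cancel_left1)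
    finally show ?thesis by (simp add: K1_def algebra_simps)
  qed
  have r_small: "r d < 2 ^ k * \<tau>" if "d \<noteq> 0" for d
  proof -
    have "M ^ 3 \<le> M ^ 4" using M1 by (intro power_increasing) auto
    also have "\<dots> = (M ^ 2) ^ 2" by (simp flip: power_mult)
    also have "\<dots> \<le> (C0 * J ^ 135) ^ 2" using small by (intro power_mono) auto
    finally have M3: "M ^ 3 \<le> C0 ^ 2 * J ^ 270" by (simp add: power_mult_distrib flip: power_mult)
    have "r d ^ 3 \<le> 16000 * M ^ 4 * n ^ 2" by (rule rep_bound_nonzero[OF that])
    also have "\<dots> = 16000 * M ^ 3 * (\<tau> ^ 3 * J ^ 6)" unfolding \<tau>3 by (simp add: power_numeral_reduce)
    also have "\<dots> \<le> 16000 * (C0 ^ 2 * J ^ 270) * (\<tau> ^ 3 * J ^ 6)"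
      using M3 \<tau> J1 by (intro mult_right_mono mult_left_mono) auto
    also have "\<dots> = x * \<tau> ^ 3" unfolding x_def by (simp add: mult_ac flip: power_add)
    also have "\<dots> < 2 ^ k * \<tau> ^ 3" using xk \<tau> by simp
    also have "\<dots> \<le> (2 ^ k) ^ 3 * \<tau> ^ 3"
    proof -
      have "(2::real) ^ k \<le> (2 ^ k) ^ 3" by (rule self_le_power) auto
      then show ?thesis using \<tau> by simp
    qed
    finally have "r d ^ 3 < (2 ^ k * \<tau>) ^ 3" by (simp add: power_mult_distrib)
    then show ?thesis by (rule power_less_imp_less_base) (use \<tau> in simp)
  qed
  have low: "(\<Sum>d\<in>{d \<in> D. r d < \<tau>}. r d * real (card (G d))) \<le> M ^ 2 * n ^ 3"
  proof -
    have "(\<Sum>d\<in>{d \<in> D. r d < \<tau>}. r d * real (card (G d))) \<le> (\<Sum>d\<in>{d \<in> D. r d < \<tau>}. \<tau> * real (card (G d)))"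
      by (intro sum_mono mult_right_mono) auto
    also have "\<dots> \<le> (\<Sum>d\<in>D. \<tau> * real (card (G d)))"
      using finD \<tau> by (intro sum_mono2) auto
    also have "\<dots> = \<tau> * (\<Sum>d\<in>D. real (card (G d)))" by (simp add: sum_distrib_left)
    also have "(\<Sum>d\<in>D. real (card (G d))) = real (card (SIGMA d:D. G d))"
      using finD finG by (simp add: card_SigmaI)
    \<comment> \<open>The roles of the differences are exchanged: \<open>a - a' = c - c'\<close>
      means \<open>a - c = a' - c'\<close>, and this common value has at most \<open>V\<close>
      representations.\<close>
    also have "card (SIGMA d:D. G d) \<le> card (SIGMA s:{s \<in> D. r s \<le> V}. diff_pairs A s \<times> diff_pairs A s)"
    proof (rule card_inj_on_le[of "\<lambda>(d, (a, a'), (c, c')). (a - c, (a, c), (a', c'))"])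
      show "inj_on (\<lambda>(d, (a, a'), (c, c')). (a - c, (a, c), (a', c'))) (SIGMA d:D. G d)"
        by (auto simp: inj_on_def G_def diff_pairs_def)
      show "(\<lambda>(d, (a, a'), (c, c')). (a - c, (a, c), (a', c'))) ` (SIGMA d:D. G d)
        \<subseteq> (SIGMA s:{s \<in> D. r s \<le> V}. diff_pairs A s \<times> diff_pairs A s)"
        by (auto simp: G_def diff_pairs_def intro: diffI)
    qed (use finD finA in auto)
    also have "real (card (SIGMA s:{s \<in> D. r s \<le> V}. diff_pairs A s \<times> diff_pairs A s))
      = (\<Sum>s\<in>{s \<in> D. r s \<le> V}. r s * r s)"
      using finD finA by (simp add: card_SigmaI card_cartesian_product rep_def)
    also have "\<dots> \<le> (\<Sum>s\<in>{s \<in> D. r s \<le> V}. V * r s)"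
      by (intro sum_mono mult_right_mono) auto
    also have "\<dots> = V * (\<Sum>s\<in>{s \<in> D. r s \<le> V}. r s)" by (simp add: sum_distrib_left)
    also have "\<dots> \<le> V * n ^ 2"
      unfolding n_def using V finD finA by (intro mult_left_mono sum_rep) auto
    finally have "(\<Sum>d\<in>{d \<in> D. r d < \<tau>}. r d * real (card (G d))) \<le> \<tau> * (V * n ^ 2)"
      using \<tau> by (simp add: mult_left_mono)
    also have "\<dots> = M ^ 2 * n ^ 3" using V by (simp add: \<tau>_def power_numeral_reduce)
    finally show ?thesis .
  qed
  have high: "(\<Sum>d\<in>{d \<in> D. \<tau> \<le> r d}. r d * real (card (G d))) \<le> n ^ 3 + 128000 * M ^ 2 * n ^ 3 * real k"
  proof -
    have "(\<Sum>d\<in>{d \<in> D. \<tau> \<le> r d}. r d * real (card (G d))) \<le> (\<Sum>d\<in>{d \<in> D. \<tau> \<le> r d}. r d * (r d * r d))"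
      by (intro sum_mono mult_left_mono Gr) auto
    \<comment> \<open>The upper bound on \<open>r d\<close> fails for the zero translation, which is
      split off at a cost of at most \<open>n ^ 3\<close>.\<close>
    also have "\<dots> \<le> (\<Sum>d\<in>insert 0 {d \<in> D. \<tau> \<le> r d \<and> r d < 2 ^ k * \<tau>}. r d * (r d * r d))"
      using finD r_small by (intro sum_mono2) auto
    also have "\<dots> \<le> r 0 * (r 0 * r 0) + (\<Sum>d\<in>{d \<in> D. \<tau> \<le> r d \<and> r d < 2 ^ k * \<tau>}. r d * (r d * r d))"
      using finD by (subst sum.insert_if) auto
    also have "r 0 * (r 0 * r 0) \<le> n * (n * n)"
      using r_le_n n_pos by (intro mult_mono) auto
    also have "(\<Sum>d\<in>{d \<in> D. \<tau> \<le> r d \<and> r d < 2 ^ k * \<tau>}. r d * (r d * r d))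
        = (\<Sum>d\<in>{d \<in> D. \<tau> \<le> r d \<and> r d < 2 ^ k * \<tau>}. r d ^ 3)"
      by (simp add: power3_eq_cube mult_ac)
    also have "\<dots> \<le> 8 * (16000 * M ^ 2 * n ^ 3) * real k"
      by (intro dyadic_window_sum finD card_popular_differences \<tau>)
    finally show ?thesis by (simp add: power3_eq_cube mult_ac)
  qed
  have "(\<Sum>d\<in>D. r d * real (card (G d))) = (\<Sum>d\<in>{d \<in> D. r d < \<tau>}. r d * real (card (G d)))
      + (\<Sum>d\<in>{d \<in> D. \<tau> \<le> r d}. r d * real (card (G d)))"
    using finD by (subst sum.union_disjoint[symmetric]) (auto intro!: sum.cong)
  also have "\<dots> \<le> M ^ 2 * n ^ 3 + (n ^ 3 + 128000 * M ^ 2 * n ^ 3 * real k)"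
    using low high by (rule add_mono)
  also have "\<dots> \<le> 130000 * M ^ 2 * n ^ 3 * real k"
  proof -
    define u where "u = M ^ 2 * n ^ 3"
    have "n ^ 3 \<le> u" unfolding u_def using M1 n_pos by simp
    moreover have "u \<le> u * real k" using mult_left_mono[of 1 "real k" u] n_pos by (simp add: k_def u_def)
    moreover have "0 \<le> u * real k" using n_pos by (simp add: u_def)
    ultimately have "u + (n ^ 3 + 128000 * (u * real k)) \<le> 130000 * (u * real k)" by linarith
    then show ?thesis by (simp add: u_def mult.assoc)
  qed
  also have "\<dots> \<le> 130000 * M ^ 2 * n ^ 3 * (K1 * root 3 J)"
    using k_bound n_pos by (intro mult_left_mono) auto
  finally show ?thesis by (simp add: G_def)
qed

text \<open>The same scheme with the restricted energy: cubing its factor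
  \<open>K1 * root 3 J\<close> leaves a single power of \<open>J\<close>.\<close>

lemma unpopular_differences_case:
  assumes V: "V > 0" "V ^ 3 = n * M ^ 5 * J ^ 6" and small: "M ^ 2 \<le> C0 * J ^ 135"
    and \<Omega>: "\<And>e a b c. (e, a, b, c) \<in> \<Omega> \<Longrightarrow>
      e \<in> A \<and> a \<in> A \<and> b \<in> A \<and> c \<in> A \<and> e * (a - b) \<in> popular_dilates k0 \<and> r (a - c) \<le> V"
    and c\<Omega>: "n ^ 4 / 4 \<le> real (card \<Omega>)"
  shows "n ^ 10 \<le> Clo * (\<delta> ^ 6 * M ^ 10 * J)"
proof -
  define Z where "Z = real (card (diff_shape ` \<Omega>))"
  define E where "E = 130000 * M ^ 2 * n ^ 3 * (K1 * root 3 J)"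
  have Z0: "Z \<ge> 0" by (simp add: Z_def)
  have Z: "Z ^ 3 * k0 ^ 2 \<le> 16000 * (n ^ 4 * \<delta> ^ 6)"
    unfolding Z_def using \<Omega> by (intro shape_bound_D[OF k0_pos k0_le_n]) blast
  have "real (card \<Omega>) ^ 2 \<le> Z * (\<Sum>e\<in>A. \<Sum>d\<in>D. r d * real (card {((a, a'), (c, c')).
      (a, a') \<in> diff_pairs A d \<and> (c, c') \<in> diff_pairs A d \<and> r (a - c) \<le> V}))"
    unfolding Z_def
    by (rule translation_energy[where Pr = "\<lambda>s. r s \<le> V"]) (use finA finD \<Omega> in \<open>auto intro: diffI\<close>)
  also have "\<dots> \<le> Z * (\<Sum>e\<in>A. E)"
    unfolding E_def by (intro mult_left_mono sum_mono restricted_energy_bound[OF V small] Z0)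
  also have "\<dots> = Z * (n * E)" by (simp add: n_def)
  finally have "real (card \<Omega>) ^ 2 \<le> Z * (n * E)" .
  moreover have "(n ^ 4 / 4) ^ 2 \<le> real (card \<Omega>) ^ 2" using c\<Omega> n_pos by (intro power_mono) auto
  ultimately have "n ^ 4 * (n ^ 4 / 16) \<le> n ^ 4 * (Z * (130000 * M ^ 2 * (K1 * root 3 J)))"
    unfolding E_def by (simp add: power_divide power_numeral_reduce mult_ac)
  then have "n ^ 4 / 16 \<le> Z * (130000 * M ^ 2 * (K1 * root 3 J))"
    using n_pos by (subst (asm) mult_le_cancel_left_pos) auto
  then have "(n ^ 4 / 16) ^ 3 \<le> (Z * (130000 * M ^ 2 * (K1 * root 3 J))) ^ 3"
    using n_pos by (intro power_mono) auto
  also have "\<dots> = Z ^ 3 * (130000 ^ 3 * M ^ 6 * (K1 ^ 3 * J))"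
    by (simp add: power_mult_distrib odd_real_root_pow flip: power_mult)
  finally have "(n ^ 4 / 16) ^ 3 * k0 ^ 2 \<le> Z ^ 3 * (130000 ^ 3 * M ^ 6 * (K1 ^ 3 * J)) * k0 ^ 2"
    by (intro mult_right_mono) auto
  also have "\<dots> = (Z ^ 3 * k0 ^ 2) * (130000 ^ 3 * M ^ 6 * (K1 ^ 3 * J))" by (simp add: mult_ac)
  also have "\<dots> \<le> 16000 * (n ^ 4 * \<delta> ^ 6) * (130000 ^ 3 * M ^ 6 * (K1 ^ 3 * J))"
    using J1 M1 K1_pos by (intro mult_right_mono[OF Z]) auto
  also have "(n ^ 4 / 16) ^ 3 * k0 ^ 2 = n ^ 4 * (n ^ 10 / (4096 * 16 * M ^ 4))"
    unfolding k0_def by (simp add: power_divide power_mult_distrib flip: power_mult power_add)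
  finally have "n ^ 4 * (n ^ 10 / (4096 * 16 * M ^ 4)) \<le> n ^ 4 * (16000 * \<delta> ^ 6 * (130000 ^ 3 * M ^ 6 * (K1 ^ 3 * J)))"
    by (simp add: mult_ac)
  then have "n ^ 10 / (4096 * 16 * M ^ 4) \<le> 16000 * \<delta> ^ 6 * (130000 ^ 3 * M ^ 6 * (K1 ^ 3 * J))"
    using n_pos by (subst (asm) mult_le_cancel_left_pos) auto
  then show ?thesis unfolding Clo_def using M1 by (simp add: divide_le_eq power_numeral_reduce mult_ac)
qed

lemma small_doubling_case:
  assumes small: "M ^ 2 \<le> C0 * J ^ 135"
  shows "n ^ 10 \<le> (Clo + Chi ^ 2) * (\<delta> ^ 6 * M ^ 10 * J)"
proof -
  define V where "V = root 3 (n * M ^ 5 * J ^ 6)"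
  have V: "V > 0" "V ^ 3 = n * M ^ 5 * J ^ 6"
    using n_pos M1 J1 by (auto simp: V_def odd_real_root_pow)
  define G where "G = {(e, a, b). e \<in> A \<and> a \<in> A \<and> b \<in> A \<and> k0 \<le> real (card (common_divisors (e * a) (e * b)))}"
  define F where "F = (\<lambda>((e, a, b), c). (e, a, b, c)) ` (G \<times> A)"
  define F1 where "F1 = {(e, a, b, c) \<in> F. V \<le> r (a - c)}"
  define F2 where "F2 = {(e, a, b, c) \<in> F. r (a - c) \<le> V}"
  have "finite G" by (rule finite_subset[of _ "A \<times> A \<times> A"]) (use finA in \<open>auto simp: G_def\<close>)
  then have finF: "finite F" using finA by (simp add: F_def)
  have "F1 \<subseteq> F" "F2 \<subseteq> F" by (auto simp: F1_def F2_def)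
  then have "finite F1" "finite F2" using finF finite_subset by blast+
  have F: "e \<in> A \<and> a \<in> A \<and> b \<in> A \<and> c \<in> A \<and> e * (a - b) \<in> popular_dilates k0"
    if "(e, a, b, c) \<in> F" for e a b c
  proof -
    have t: "(e, a, b) \<in> G" "c \<in> A" using that by (auto simp: F_def)
    have "card (common_divisors (e * a) (e * b)) \<le> card (dilators (e * (a - b)))"
      using common_divisors_subset by (intro card_mono) auto
    then show ?thesis using t by (auto simp: popular_dilates_def G_def)
  qed
  have "real (card F) = real (card G) * n"
    unfolding F_def n_def by (subst card_image) (auto simp: inj_on_def card_cartesian_product)
  also have "\<dots> \<ge> 3 / 4 * n ^ 3 * n"
    using popular_triples n_pos by (intro mult_right_mono) (auto simp: G_def)
  finally have "3 / 4 * n ^ 4 \<le> real (card F)" by (simp add: power_numeral_reduce mult_ac)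
  moreover have "card F \<le> card (F1 \<union> F2)"
    using \<open>finite F1\<close> \<open>finite F2\<close> by (intro card_mono) (auto simp: F1_def F2_def)
  then have "real (card F) \<le> real (card F1) + real (card F2)"
    using card_Un_le[of F1 F2] by linarith
  ultimately consider "n ^ 4 / 2 \<le> real (card F1)" | "n ^ 4 / 4 \<le> real (card F2)" by linarith
  then show ?thesis
  proof cases
    case 1
    have "n ^ 10 \<le> Chi ^ 2 * (\<delta> ^ 6 * M ^ 10)"
      by (rule popular_differences_case[OF V _ 1]) (use F in \<open>auto simp: F1_def\<close>)
    also have "\<dots> \<le> Chi ^ 2 * (\<delta> ^ 6 * M ^ 10 * J)"
      using mult_left_mono[OF J1, of "\<delta> ^ 6 * M ^ 10"] M1 by (intro mult_left_mono) auto
    also have "\<dots> \<le> (Clo + Chi ^ 2) * (\<delta> ^ 6 * M ^ 10 * J)"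
      using J1 M1 K1_pos by (intro mult_right_mono) (auto simp: Clo_def)
    finally show ?thesis .
  next
    case 2
    have "n ^ 10 \<le> Clo * (\<delta> ^ 6 * M ^ 10 * J)"
      by (rule unpopular_differences_case[OF V small _ 2]) (use F in \<open>auto simp: F2_def\<close>)
    also have "\<dots> \<le> (Clo + Chi ^ 2) * (\<delta> ^ 6 * M ^ 10 * J)"
      using J1 M1 by (intro mult_right_mono) auto
    finally show ?thesis .
  qed
qed

section \<open>Combination of the cases and passage to the final inequality\<close>

lemma main_bound:
  "n ^ 10 \<le> (1 + 16 * (4 ^ 6 * 16000 * 256000 ^ 3) + Clo + Chi ^ 2) * (\<delta> ^ 6 * M ^ 10 * J)"
    (is "_ \<le> ?C * ?t")
proof -
  have t0: "?t \<ge> 0" using J1 M1 by simp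
  have Cs: "Clo \<ge> 0" "Chi ^ 2 \<ge> 0" using K1_pos by (auto simp: Clo_def)
  \<comment> \<open>The first alternative is already the claim without a logarithm; its negation
    supplies the smallness assumption needed for the mixed energy when \<open>M\<close> is
    large.\<close>
  consider "n ^ 10 \<le> \<delta> ^ 6 * M ^ 10" | "\<delta> ^ 6 * M ^ 10 \<le> n ^ 10" "C0 * J ^ 135 \<le> M ^ 2"
    | "M ^ 2 \<le> C0 * J ^ 135" by linarith
  then obtain c where "n ^ 10 \<le> c * ?t" "c \<le> ?C"
  proof cases
    case 1
    then have "n ^ 10 \<le> 1 * ?t"
      using mult_left_mono[OF J1, of "\<delta> ^ 6 * M ^ 10"] M1 by simp
    then show ?thesis by (rule that) (use Cs in simp)
  next
    case 2
    then have "W \<le> n ^ 5 / J" by (intro mixed_energy_bound) (simp_all add: C0_def)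
    from large_doubling_case[OF this] show ?thesis by (rule that) (use Cs in simp)
  next
    case 3
    from small_doubling_case[OF this] show ?thesis by (rule that) simp
  qed
  then show ?thesis using t0 by (meson mult_right_mono order_trans)
qed

end

theorem theorem2:
  shows "\<exists>c::real. c > 0 \<and>
    (\<forall>A::real set. finite A \<longrightarrow> card A > 1 \<longrightarrow> 0 \<notin> A \<longrightarrow>
      real (card (difference_set A A)) ^ 3 * real (card (product_set A A)) ^ 5
        \<ge> c * (real (card A) ^ 10 / (log 2 (real (card A))) powr (1/2)))"
proof -
  define C where "C = 1 + 16 * (4 ^ 6 * 16000 * 256000 ^ 3) + Clo + Chi ^ 2"
  have C: "C > 0" using K1_pos by (simp add: C_def Clo_def add_pos_nonneg)
  have "real (card (difference_set A A)) ^ 3 * real (card (product_set A A)) ^ 5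
      \<ge> 1 / sqrt C * (real (card A) ^ 10 / (log 2 (real (card A))) powr (1/2))"
    if A: "finite A" "card A > 1" "0 \<notin> A" for A :: "real set"
  proof -
    interpret nonzero_set A by unfold_locales (use A in auto)
    \<comment> \<open>The factor \<open>n ^ 10\<close> turns \<open>M ^ 10\<close> into
      \<open>P ^ 10\<close>, making the right-hand side \<open>C * J\<close> times a square; the
      square root then produces the exponent 1/2 of the logarithm.\<close>
    have "n ^ 20 \<le> C * (\<delta> ^ 6 * M ^ 10 * J) * n ^ 10"
      using mult_right_mono[OF main_bound, of "n ^ 10"] n_pos by (simp add: C_def flip: power_add)
    also have "\<dots> = C * J * (\<delta> ^ 3 * P ^ 5) ^ 2"
      unfolding P_eq by (simp add: power_mult_distrib mult_ac flip: power_mult)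
    finally have "sqrt (n ^ 20) \<le> sqrt (C * J * (\<delta> ^ 3 * P ^ 5) ^ 2)" by simp
    moreover have "sqrt (n ^ 20) = n ^ 10"
      using n_pos real_sqrt_abs[of "n ^ 10"] by (simp flip: power_mult)
    moreover have "sqrt (C * J * (\<delta> ^ 3 * P ^ 5) ^ 2) = sqrt C * sqrt J * (\<delta> ^ 3 * P ^ 5)"
      by (simp add: real_sqrt_mult abs_mult \<delta>_def P_def)
    ultimately have "n ^ 10 \<le> sqrt C * sqrt J * (\<delta> ^ 3 * P ^ 5)" by simp
    moreover have "J powr (1/2) = sqrt J" using J1 by (simp add: powr_half_sqrt)
    ultimately have "1 / sqrt C * (n ^ 10 / J powr (1/2)) \<le> \<delta> ^ 3 * P ^ 5"
      using C J1 by (simp add: divide_le_eq mult_ac)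
    then show ?thesis by (simp add: n_def \<delta>_def P_def J_def)
  qed
  moreover have "1 / sqrt C > 0" using C by simp
  ultimately show ?thesis by blast
qed

end
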